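(* Let $n\ge2$. For $a>0$ let $u^a:[0,\infty)\to\mathbb{R}$ be the solution of $$\frac{u_{rr}}{1+ u_r^2} - \frac{n-1}{u} + \frac{1}{2}r u_r - \frac{1}{2}u = 0,\qquad u(0)=a,\quad u_r(0)=\frac{\sqrt3}{3},$$ and let $m(a)=\lim_{r\to\infty}\frac{u^a(r)}{r}\in(0,\infty)$. There is an $M_0 > 0$ such that for all $M > M_0$, there exist at least two distinct values $a_1, a_2 \in (0,\infty)$ depending on $M$ such that $m(a_1) = m(a_2) = M$.
   Context: The ODE is the self-expander equation $H_\Sigma=x^\perp/2$ for rotationally symmetric hypersurfaces with profile function $u$ (radius as a function $u(r)$ of the distance $r=|x_1|$ along the axis); the initial slope $\frac{\sqrt3}{3}$ corresponds to a triple junction (three sheets meeting at angles $2\pi/3$) on $\{x_1=0\}$. For every $a>0$ the solution $u^a$ is positive and the limit defining $m(a)$ exists in $(0,\infty)$. *)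

theory Defs
  imports Complex_Main "HOL-Library.FuncSet"
begin

text \<open>
  Derivatives are taken within \<open>{0..}\<close>, hence one-sided at \<open>r = 0\<close>; \<open>v\<close> and \<open>w\<close> are
  \<open>u\<^sub>r\<close> and \<open>u\<^sub>r\<^sub>r\<close>. The condition \<open>u r > 0\<close> says that the solution stays in the domain of the
  equation, which is singular at \<open>u = 0\<close> (HOL would read \<open>(n - 1) / 0\<close> as \<open>0\<close>). Since
  \<open>u 0 = a > 0\<close> and \<open>u\<close> is continuous, it amounts to \<open>u r \<noteq> 0\<close>.
\<close>

definition expander_solution :: "nat \<Rightarrow> real \<Rightarrow> (real \<Rightarrow> real) \<Rightarrow> bool" where
  "expander_solution n a u \<longleftrightarrow>
     (\<exists>v w. (\<forall>r\<ge>0.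
          u r > 0 \<and>
          (u has_real_derivative v r) (at r within {0..}) \<and>
          (v has_real_derivative w r) (at r within {0..}) \<and>
          w r / (1 + (v r)\<^sup>2) - (real n - 1) / u r + 1/2 * r * v r - 1/2 * u r = 0) \<and>
        u 0 = a \<and> v 0 = sqrt 3 / 3)"

text \<open>
  A function on \<open>[0,\<infinity>)\<close> is represented by its extensional representative, so that the
  solution is a unique object of type \<^typ>\<open>real \<Rightarrow> real\<close>.
\<close>

definition expander_profile :: "nat \<Rightarrow> real \<Rightarrow> real \<Rightarrow> real" where
  "expander_profile n a = (THE u. u \<in> extensional {0..} \<and> expander_solution n a u)"

definition asymptotic_slope :: "nat \<Rightarrow> real \<Rightarrow> real" where
  "asymptotic_slope n a = Lim at_top (\<lambda>r. expander_profile n a r / r)"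

end

theory Submission
  imports Defs "HOL-Analysis.Analysis"
begin

text \<open>
  Write \<open>v = u\<^sub>r\<close> and let \<open>\<phi> = u - r v\<close>. The equation says that the angle \<open>arctan v\<close> has
  derivative \<open>(n - 1)/u + \<phi>/2\<close>, and \<open>(u/r)' = -\<phi>/r\<^sup>2\<close>, so a bound on \<open>\<phi>\<close> controls how far \<open>u/r\<close>
  is from its limit. The theorem follows from the intermediate value theorem once the limit
  slope \<open>m\<close> is known to be continuous and to tend to \<open>\<infinity>\<close> both as \<open>a \<rightarrow> 0\<close> and as \<open>a \<rightarrow> \<infinity>\<close>:
  every value above \<open>max 1 (m 1)\<close> is then attained on each side of \<open>a = 1\<close>.

  Well-posedness and continuity rest on a priori bounds (\<open>support_bounded\<close>, \<open>slope_bounded\<close>)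
  that depend only on a compact range of initial radii and not on the length of the interval.
  They allow the right-hand side to be clamped to a box without changing the solution, which
  gives global existence by a contraction argument (\<open>expander_arc_exists\<close>). On the box the
  right-hand side is Lipschitz, so solutions depend continuously on \<open>a\<close>
  (\<open>expander_arcs_close\<close>). Since \<open>u(R)/R\<close> approaches \<open>m\<close> at the uniform rate \<open>C/R\<close>, the limit
  inherits this continuity (\<open>continuous_on_asymptotic_slope\<close>).

  The blow-up of \<open>m\<close> uses the bound \<open>m \<ge> min (v R) (u R / R)\<close>, valid for every \<open>R > 0\<close>
  (\<open>asymptotic_slope_lower_bound\<close>): it suffices to exhibit one point of the curve where both
  quantities are large. For large \<open>a\<close> the term \<open>\<phi>/2\<close> turns the curve almost vertical before
  \<open>r = 1\<close>, while \<open>u \<ge> a\<close>. For small \<open>a\<close> the term \<open>(n - 1)/u\<close> dominates and the curve resembles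
  a catenoid of size \<open>a\<close>, whose slope exceeds any given bound at some \<open>R\<close> proportional to \<open>a\<close>;
  a large slope on \<open>[R, 2 R]\<close> then makes \<open>u/r\<close> large as well.
\<close>

section \<open>Barriers and monotonicity on an interval\<close>

text \<open>
  Excluding zeros under the assumption of positivity at all earlier times is enough, since a
  continuous function that becomes non-positive has a first zero. This makes bounds on the
  past of a solution available when its present is estimated.
\<close>
lemma no_first_zero_imp_pos:
  fixes g :: "real \<Rightarrow> real"
  assumes cont: "continuous_on {a..b} g" and init: "g a > 0"
    and no_zero: "\<And>t. a < t \<Longrightarrow> t \<le> b \<Longrightarrow> (\<And>s. a \<le> s \<Longrightarrow> s < t \<Longrightarrow> g s > 0) \<Longrightarrow> g t \<noteq> 0"
    and t: "a \<le> t" "t \<le> b"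
  shows "g t > 0"
proof (rule ccontr)
  assume "\<not> g t > 0"
  define Z where "Z = {s \<in> {a..t}. g s \<le> 0}"
  have cont_t: "continuous_on {a..t} g"
    using cont t by (auto intro: continuous_on_subset)
  have "compact Z"
  proof -
    have "closed Z"
      using continuous_closed_preimage[OF cont_t closed_real_atLeastAtMost, of "{..0}"]
      by (auto simp: Z_def vimage_def Int_def)
    then show ?thesis
      unfolding compact_eq_bounded_closed
      by (auto simp: Z_def intro: bounded_subset[OF bounded_closed_interval])
  qed
  moreover have "Z \<noteq> {}"
    using \<open>\<not> g t > 0\<close> t by (auto simp: Z_def)
  ultimately obtain z where z: "z \<in> Z" and least: "\<And>s. s \<in> Z \<Longrightarrow> z \<le> s"
    using compact_attains_inf[of Z] by auto
  have before: "g s > 0" if "a \<le> s" "s < z" for s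
    using least[of s] that z by (force simp: Z_def)
  have "a < z"
    using init z by (cases "a = z") (auto simp: Z_def)
  moreover have "g z = 0"
  proof (rule ccontr)
    assume "g z \<noteq> 0"
    then have "g z < 0"
      using z by (auto simp: Z_def)
    moreover have "continuous_on {a..z} g"
      using cont_t z by (auto simp: Z_def intro: continuous_on_subset)
    ultimately obtain s where "a \<le> s" "s \<le> z" "g s = 0"
      using IVT2'[of g z 0 a] init \<open>a < z\<close> by auto
    then show False
      using before[of s] \<open>g z \<noteq> 0\<close> by (cases "s = z") auto
  qed
  ultimately show False
    using no_zero[of z] before z t by (auto simp: Z_def)
qed

text \<open>At a first zero the derivative from the left cannot be positive.\<close>
lemma barrier_imp_pos:
  fixes g :: "real \<Rightarrow> real"
  assumes deriv: "\<And>t. a \<le> t \<Longrightarrow> t \<le> b \<Longrightarrow> (g has_real_derivative g' t) (at t within {a..b})"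
    and init: "g a > 0"
    and barrier: "\<And>t. a < t \<Longrightarrow> t \<le> b \<Longrightarrow> (\<And>s. a \<le> s \<Longrightarrow> s < t \<Longrightarrow> g s > 0) \<Longrightarrow> g t = 0
      \<Longrightarrow> g' t > 0"
    and t: "a \<le> t" "t \<le> b"
  shows "g t > 0"
proof (rule no_first_zero_imp_pos[where g = g and t = t and a = a and b = b])
  show "continuous_on {a..b} g"
    using deriv by (intro DERIV_continuous_on) auto
next
  fix t assume t: "a < t" "t \<le> b" and before: "\<And>s. a \<le> s \<Longrightarrow> s < t \<Longrightarrow> g s > 0"
  show "g t \<noteq> 0"
  proof
    assume zero: "g t = 0"
    have "g' t > 0"
      using t before zero by (intro barrier) auto
    then obtain d where d: "d > 0"
      and less: "\<And>h. 0 < h \<Longrightarrow> t - h \<in> {a..b} \<Longrightarrow> h < d \<Longrightarrow> g (t - h) < g t"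
      using has_real_derivative_pos_inc_left[OF deriv[of t]] t by auto
    define h where "h = min (d / 2) (t - a)"
    have "0 < h" "h < d" "t - h \<in> {a..b}" "a \<le> t - h" "t - h < t"
      using d t by (auto simp: h_def min_def)
    then show False
      using less[of h] before[of "t - h"] zero by simp
  qed
qed (use init t in auto)

lemma nondecreasing_if_deriv_nonneg:
  fixes f :: "real \<Rightarrow> real"
  assumes "s \<le> t"
    and deriv: "\<And>r. s \<le> r \<Longrightarrow> r \<le> t \<Longrightarrow> (f has_real_derivative f' r) (at r within {s..t})"
    and nonneg: "\<And>r. s < r \<Longrightarrow> r < t \<Longrightarrow> 0 \<le> f' r"
  shows "f s \<le> f t"
proof (rule DERIV_nonneg_imp_increasing_open[OF \<open>s \<le> t\<close>])
  show "continuous_on {s..t} f"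
    using deriv by (intro DERIV_continuous_on) auto
  show "\<exists>y. DERIV f r :> y \<and> 0 \<le> y" if "s < r" "r < t" for r
    using deriv[of r] nonneg[of r] that by (auto simp: at_within_Icc_at)
qed

section \<open>Initial value problems with a globally Lipschitz right-hand side\<close>

text \<open>
  The Picard operator is conjugated with the weight \<open>exp (l t)\<close>. For \<open>l > 2 |L|\<close> it becomes a
  contraction on the whole interval at once, whatever its length: the Lipschitz constant of
  the integral is \<open>L \<integral> exp (l s) ds \<le> (L/l) exp (l t)\<close>.
\<close>
theorem lipschitz_ivp_solvable:
  fixes F :: "real \<Rightarrow> 'a::banach \<Rightarrow> 'a"
  assumes "T \<ge> 0"
    and cont: "continuous_on ({0..T} \<times> UNIV) (\<lambda>(t, x). F t x)"
    and lip: "\<And>t x y. 0 \<le> t \<Longrightarrow> t \<le> T \<Longrightarrow> norm (F t x - F t y) \<le> L * norm (x - y)"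
  obtains z where "z 0 = z0"
    and "\<And>t. 0 \<le> t \<Longrightarrow> t \<le> T \<Longrightarrow> (z has_vector_derivative F t (z t)) (at t within {0..T})"
proof -
  define l where "l = 2 * \<bar>L\<bar> + 1"
  have l: "l > 0" and L_le: "L \<le> \<bar>L\<bar>"
    by (auto simp: l_def)
  define G where "G y t = F t (exp (l * t) *\<^sub>R y t)" for y :: "real \<Rightarrow> 'a" and t
  define I where "I y t = exp (- l * t) *\<^sub>R (z0 + integral {0..t} (G y))" for y and t
  have G_cont: "continuous_on {0..T} (G y)" if "continuous_on {0..T} y" for y
  proof -
    have "continuous_on {0..T} (\<lambda>t. (t, exp (l * t) *\<^sub>R y t))"
      using that by (intro continuous_intros)
    then have "continuous_on {0..T} (\<lambda>t. case (t, exp (l * t) *\<^sub>R y t) of (t, x) \<Rightarrow> F t x)"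
      by (rule continuous_on_compose2[OF cont]) auto
    then show ?thesis
      by (simp add: G_def[abs_def])
  qed
  have G_int: "G y integrable_on {0..t}" if "continuous_on {0..T} y" "t \<le> T" for y t
    using G_cont[OF that(1)] that(2)
    by (intro integrable_continuous_real) (auto intro: continuous_on_subset)
  have I_cont: "continuous_on {0..T} (I y)" if "continuous_on {0..T} y" for y
    unfolding I_def using indefinite_integral_continuous_1[OF G_int[OF that order_refl]]
    by (auto intro!: continuous_intros)
  \<comment> \<open>Composition with \<open>clamp 0 T\<close> extends functions on \<open>[0,T]\<close> to bounded continuous functions on
    the line, the complete space in which the fixed point is taken.\<close>
  have "\<exists>g. \<forall>t. apply_bcontfun g t = I (apply_bcontfun y) (clamp 0 T t)" for y :: "real \<Rightarrow>\<^sub>C 'a"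
    using continuous_on_cbox_bcontfunE[of 0 T "I (apply_bcontfun y)"] I_cont[of "apply_bcontfun y"]
    by (metis continuous_on_apply_bcontfun interval_cbox)
  then obtain P :: "(real \<Rightarrow>\<^sub>C 'a) \<Rightarrow> (real \<Rightarrow>\<^sub>C 'a)" where
    P: "\<And>y t. apply_bcontfun (P y) t = I (apply_bcontfun y) (clamp 0 T t)"
    by metis
  have I_contract: "norm (I x t - I y t) \<le> 1 / 2 * dist x y"
    if t: "0 \<le> t" "t \<le> T" for x y :: "real \<Rightarrow>\<^sub>C 'a" and t
  proof -
    let ?d = "dist x y"
    have "((\<lambda>s. \<bar>L\<bar> * exp (l * s) * ?d) has_integral
        \<bar>L\<bar> * exp (l * t) * ?d / l - \<bar>L\<bar> * exp (l * 0) * ?d / l) {0..t}"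
      using t l
      by (intro fundamental_theorem_of_calculus)
         (auto intro!: derivative_eq_intros simp: has_real_derivative_iff_has_vector_derivative[symmetric])
    then have has: "((\<lambda>s. \<bar>L\<bar> * exp (l * s) * ?d) has_integral \<bar>L\<bar> * ?d / l * (exp (l * t) - 1)) {0..t}"
      using l by (simp add: field_simps)
    have "norm (integral {0..t} (\<lambda>s. G x s - G y s)) \<le> integral {0..t} (\<lambda>s. \<bar>L\<bar> * exp (l * s) * ?d)"
    proof (rule integral_norm_bound_integral)
      show "(\<lambda>s. G x s - G y s) integrable_on {0..t}"
        using t by (intro integrable_diff G_int) auto
      show "(\<lambda>s. \<bar>L\<bar> * exp (l * s) * ?d) integrable_on {0..t}"
        using has by blast
    next
      fix s assume s: "s \<in> {0..t}"
      have "norm (G x s - G y s) \<le> L * norm (exp (l * s) *\<^sub>R (x s - y s))"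
        using lip[of s "exp (l * s) *\<^sub>R x s" "exp (l * s) *\<^sub>R y s"] s t
        by (simp add: G_def scaleR_diff_right)
      also have "\<dots> \<le> \<bar>L\<bar> * (exp (l * s) * ?d)"
        using dist_bounded[of x s y] L_le by (intro mult_mono) (auto simp: dist_norm)
      finally show "norm (G x s - G y s) \<le> \<bar>L\<bar> * exp (l * s) * ?d"
        by (simp add: mult.assoc)
    qed
    also have "\<dots> = \<bar>L\<bar> * ?d / l * (exp (l * t) - 1)"
      using has by (rule integral_unique)
    also have "\<dots> \<le> \<bar>L\<bar> * ?d / l * exp (l * t)"
      using l by (intro mult_left_mono) auto
    finally have bound: "norm (integral {0..t} (\<lambda>s. G x s - G y s)) \<le> \<bar>L\<bar> * ?d / l * exp (l * t)" .
    have "I x t - I y t = exp (- l * t) *\<^sub>R integral {0..t} (\<lambda>s. G x s - G y s)"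
      using t by (simp add: I_def integral_diff G_int algebra_simps)
    then have "norm (I x t - I y t) = exp (- l * t) * norm (integral {0..t} (\<lambda>s. G x s - G y s))"
      by simp
    also have "\<dots> \<le> exp (- l * t) * (\<bar>L\<bar> * ?d / l * exp (l * t))"
      using bound by (rule mult_left_mono) simp
    also have "\<dots> = \<bar>L\<bar> / l * ?d"
      by (simp add: exp_minus)
    also have "\<dots> \<le> 1 / 2 * ?d"
      by (intro mult_right_mono) (auto simp: l_def field_simps)
    finally show ?thesis .
  qed
  have "dist (P x) (P y) \<le> 1 / 2 * dist x y" for x y
  proof (rule dist_bound)
    fix t :: real
    have "clamp 0 T t \<in> cbox 0 T"
      using \<open>T \<ge> 0\<close> by (intro clamp_in_interval) auto
    then show "dist (P x t) (P y t) \<le> 1 / 2 * dist x y"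
      using I_contract[of "clamp 0 T t" x y] by (simp add: P dist_norm)
  qed
  then obtain y where y: "P y = y"
    using banach_fix_type[of "1 / 2" P] by auto
  have fixpoint: "y t = I y t" if "0 \<le> t" "t \<le> T" for t
    using P[of y t] that by (simp add: y)
  define z where "z t = z0 + integral {0..t} (G y)" for t
  have zy: "exp (l * t) *\<^sub>R y t = z t" if "0 \<le> t" "t \<le> T" for t
    using fixpoint[OF that] by (simp add: I_def z_def exp_minus)
  show ?thesis
  proof
    show "z 0 = z0"
      by (simp add: z_def)
    show "(z has_vector_derivative F t (z t)) (at t within {0..T})" if t: "0 \<le> t" "t \<le> T" for t
    proof -
      have "((\<lambda>t. integral {0..t} (G y)) has_vector_derivative G y t) (at t within {0..T})"
        using t by (intro integral_has_vector_derivative G_cont) auto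
      then show ?thesis
        using zy[OF t] by (auto simp: z_def[abs_def] G_def intro!: derivative_eq_intros)
    qed
  qed
qed

section \<open>A priori bounds for solution arcs\<close>

text \<open>
  The derivative of \<open>arctan u\<^sub>r\<close> along a solution, as a function of \<open>r\<close>, \<open>x = u\<close> and \<open>y = u\<^sub>r\<close>.
\<close>
definition angle_rate :: "nat \<Rightarrow> real \<Rightarrow> real \<Rightarrow> real \<Rightarrow> real" where
  "angle_rate n r x y = (real n - 1) / x + (x - r * y) / 2"

text \<open>
  An arc is a solution on a compact interval. The half-line is treated through its initial
  pieces because solutions are first constructed on such intervals, and the bounds have to hold
  before global existence is known.
\<close>
locale expander_arc =
  fixes n :: nat and a T :: real and u v :: "real \<Rightarrow> real"
  assumes dim: "n \<ge> 2" and T_pos: "T > 0" and a_pos: "a > 0"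
    and u_0: "u 0 = a" and v_0: "v 0 = sqrt 3 / 3"
    and u_pos: "\<And>r. 0 \<le> r \<Longrightarrow> r \<le> T \<Longrightarrow> u r > 0"
    and u_deriv: "\<And>r. 0 \<le> r \<Longrightarrow> r \<le> T \<Longrightarrow> (u has_real_derivative v r) (at r within {0..T})"
    and v_deriv: "\<And>r. 0 \<le> r \<Longrightarrow> r \<le> T \<Longrightarrow>
      (v has_real_derivative (1 + (v r)\<^sup>2) * angle_rate n r (u r) (v r)) (at r within {0..T})"
begin

text \<open>
  Up to the factor \<open>(1 + v\<^sup>2)\<^sup>-\<^sup>1\<^sup>/\<^sup>2\<close>, this is the support function of the profile curve: the
  signed distance of its tangent line from the origin.
\<close>
definition support :: "real \<Rightarrow> real" where
  "support r = u r - r * v r"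

lemma angle_rate_support: "angle_rate n r (u r) (v r) = (real n - 1) / u r + support r / 2"
  by (simp add: angle_rate_def support_def)

lemma dim_real: "real n - 1 \<ge> 1"
  using dim by linarith

lemma support_deriv:
  assumes "0 \<le> r" "r \<le> T"
  shows "(support has_real_derivative - (r * ((1 + (v r)\<^sup>2) * angle_rate n r (u r) (v r)))) (at r within {0..T})"
  unfolding support_def[abs_def]
  by (rule derivative_eq_intros u_deriv[OF assms] v_deriv[OF assms] refl | simp)+

text \<open>At a horizontal tangent both terms of the angle rate are positive, so the curve turns up.\<close>
lemma slope_pos:
  assumes "0 \<le> r" "r \<le> T"
  shows "v r > 0"
proof (rule barrier_imp_pos[where a = 0 and b = T, OF v_deriv])
  fix t assume t: "0 < t" "t \<le> T" "v t = 0"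
  then have "u t > 0"
    by (intro u_pos) auto
  then show "0 < (1 + (v t)\<^sup>2) * angle_rate n t (u t) (v t)"
    using t dim_real by (auto simp: angle_rate_def intro!: add_nonneg_pos)
qed (use assms in \<open>simp_all add: v_0\<close>)

lemma u_increasing:
  assumes "0 \<le> r" "r \<le> s" "s \<le> T"
  shows "u r \<le> u s"
proof (rule nondecreasing_if_deriv_nonneg[OF \<open>r \<le> s\<close>])
  show "(u has_real_derivative v t) (at t within {r..s})" if "r \<le> t" "t \<le> s" for t
    using that assms by (intro DERIV_subset[OF u_deriv]) auto
  show "0 \<le> v t" if "r < t" "t < s" for t
    using slope_pos[of t] that assms by auto
qed

lemma u_ge: "0 \<le> r \<Longrightarrow> r \<le> T \<Longrightarrow> a \<le> u r"
  using u_increasing[of 0 r] u_0 by simp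

text \<open>
  Strictness makes the barrier in \<open>support_lower\<close> strict.
\<close>
lemma u_greater:
  assumes "0 < r" "r \<le> T"
  shows "a < u r"
proof (rule ccontr)
  assume "\<not> a < u r"
  then have const: "u s = a" if "0 \<le> s" "s \<le> r" for s
    using u_increasing[of 0 s] u_increasing[of s r] that assms u_0 by force
  have "(u has_real_derivative v (r/2)) (at (r/2))"
    using u_deriv[of "r/2"] assms by (simp add: at_within_Icc_at)
  moreover have "(u has_real_derivative 0) (at (r/2))"
    using assms const
    by (intro has_field_derivative_transform_within_open[OF DERIV_const[of a], where S = "{0<..<r}"]) auto
  ultimately have "v (r/2) = 0"
    by (rule DERIV_unique)
  then show False
    using slope_pos[of "r/2"] assms by auto
qed

text \<open>
  The support function decreases exactly where the angle increases, so the level \<open>-2(n-1)/a\<close>,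
  below which the angle rate would be negative, stops it from below.
\<close>
lemma support_lower:
  assumes "0 \<le> r" "r \<le> T"
  shows "support r > - (2 * (real n - 1) / a)"
proof -
  have "0 < support r + 2 * (real n - 1) / a"
  proof (rule barrier_imp_pos[where g = "\<lambda>r. support r + 2 * (real n - 1) / a" and a = 0 and b = T])
    show "((\<lambda>r. support r + 2 * (real n - 1) / a) has_real_derivative
        - (t * ((1 + (v t)\<^sup>2) * angle_rate n t (u t) (v t)))) (at t within {0..T})"
      if "0 \<le> t" "t \<le> T" for t
      by (rule derivative_eq_intros support_deriv that refl | simp)+
    show "0 < support 0 + 2 * (real n - 1) / a"
      using a_pos dim_real by (auto simp: support_def u_0 intro!: add_pos_nonneg)
  next
    fix t assume t: "0 < t" "t \<le> T" and "support t + 2 * (real n - 1) / a = 0"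
    then have "support t = - (2 * (real n - 1) / a)"
      by linarith
    then have "angle_rate n t (u t) (v t) = (real n - 1) / u t - (real n - 1) / a"
      by (simp add: angle_rate_support diff_divide_distrib)
    also have "\<dots> < 0"
      using u_greater[OF t] a_pos dim_real by (simp add: frac_less2)
    finally show "0 < - (t * ((1 + (v t)\<^sup>2) * angle_rate n t (u t) (v t)))"
      using t by (simp add: mult_pos_neg add_pos_nonneg)
  qed (use assms in auto)
  moreover have "- k < x" if "0 < x + k" for x k :: real
    using that by linarith
  ultimately show ?thesis
    by blast
qed

text \<open>
  Where the support function is positive, so is the angle rate, and the support function decreases.
\<close>
lemma support_upper_from:
  assumes r: "0 \<le> q" "q \<le> r" "r \<le> T" and c: "support q < c" "0 < c"
  shows "support r < c"
proof -
  have "0 < c - support r"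
  proof (rule barrier_imp_pos[where g = "\<lambda>r. c - support r" and a = q and b = T])
    show "((\<lambda>r. c - support r) has_real_derivative
        t * ((1 + (v t)\<^sup>2) * angle_rate n t (u t) (v t))) (at t within {q..T})"
      if "q \<le> t" "t \<le> T" for t
      using that r(1)
      by (auto intro!: derivative_eq_intros DERIV_subset[OF support_deriv])
  next
    fix t assume t: "q < t" "t \<le> T" and "c - support t = 0"
    moreover have "u t > 0"
      using t r by (intro u_pos) auto
    ultimately show "0 < t * ((1 + (v t)\<^sup>2) * angle_rate n t (u t) (v t))"
      using c r dim_real by (auto simp: angle_rate_support intro!: mult_pos_pos add_pos_nonneg)
  qed (use r c in auto)
  then show ?thesis
    by simp
qed

end

text \<open>
  The bounds \<open>C = support_bound n \<alpha> \<beta>\<close> on \<open>|u - r u\<^sub>r|\<close> and \<open>slope_bound n \<alpha> \<beta>\<close> on \<open>u\<^sub>r\<close> are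
  uniform for initial radii in \<open>[\<alpha>, \<beta>]\<close>. The angle \<open>arctan u\<^sub>r\<close> starts at
  \<open>\<pi>/6\<close>, so with rate at most \<open>(n - 1)/\<alpha> + C/2\<close> it cannot pass \<open>\<pi>/3\<close> before
  \<open>r = free_radius n \<alpha> \<beta>\<close>. From there on the slope is controlled by the decreasing
  quantity \<open>(u + C)/r\<close>.
\<close>
definition support_bound :: "nat \<Rightarrow> real \<Rightarrow> real \<Rightarrow> real" where
  "support_bound n \<alpha> \<beta> = \<beta> + 2 * (real n - 1) / \<alpha> + 1"

definition free_radius :: "nat \<Rightarrow> real \<Rightarrow> real \<Rightarrow> real" where
  "free_radius n \<alpha> \<beta> = (pi / 6) / ((real n - 1) / \<alpha> + support_bound n \<alpha> \<beta> / 2)"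

definition slope_bound :: "nat \<Rightarrow> real \<Rightarrow> real \<Rightarrow> real" where
  "slope_bound n \<alpha> \<beta> = 2 + (\<beta> + support_bound n \<alpha> \<beta>) / free_radius n \<alpha> \<beta>"

lemma support_bound_pos:
  assumes "n \<ge> 2" "0 < \<alpha>" "\<alpha> \<le> \<beta>"
  shows "support_bound n \<alpha> \<beta> > 0"
  using assms by (auto simp: support_bound_def intro!: add_nonneg_pos)

lemma free_radius_pos:
  assumes "n \<ge> 2" "0 < \<alpha>" "\<alpha> \<le> \<beta>"
  shows "free_radius n \<alpha> \<beta> > 0"
  using assms support_bound_pos[OF assms]
  by (auto simp: free_radius_def intro!: divide_pos_pos add_nonneg_pos)

context expander_arc
begin

context
  fixes \<alpha> \<beta> :: real
  assumes \<alpha>: "0 < \<alpha>" "\<alpha> \<le> a" and \<beta>: "a \<le> \<beta>"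
begin

lemma \<alpha>\<beta>: "\<alpha> \<le> \<beta>"
  using \<alpha> \<beta> by simp

lemma support_bounded:
  assumes "0 \<le> r" "r \<le> T"
  shows "\<bar>support r\<bar> < support_bound n \<alpha> \<beta>"
proof -
  define p q where "p = 2 * (real n - 1) / a" and "q = 2 * (real n - 1) / \<alpha>"
  have "p \<le> q"
    unfolding p_def q_def using \<alpha> dim_real by (intro divide_left_mono mult_pos_pos) auto
  moreover have "0 \<le> q"
    using \<alpha> dim_real by (auto simp: q_def)
  \<comment> \<open>The margin \<open>1\<close> makes the bound strict at \<open>r = 0\<close>, where the support function equals \<open>a\<close>.\<close>
  moreover have "support r < a + 1"
    using a_pos u_0 assms support_upper_from[of 0 r "a + 1"] by (simp add: support_def[of 0])
  moreover have "- p < support r"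
    using support_lower[OF assms] by (simp only: p_def)
  ultimately show ?thesis
    using \<alpha> \<beta> unfolding support_bound_def q_def[symmetric] by linarith
qed

lemma slope_before_free_radius:
  assumes r: "0 \<le> r" "r \<le> T" "r \<le> free_radius n \<alpha> \<beta>"
  shows "v r \<le> sqrt 3"
proof -
  define K where "K = (real n - 1) / \<alpha> + support_bound n \<alpha> \<beta> / 2"
  have K: "K > 0"
    using \<alpha> dim_real support_bound_pos[OF dim \<alpha>(1) \<alpha>\<beta>]
    by (auto simp: K_def intro!: add_nonneg_pos)
  have "K * 0 - arctan (v 0) \<le> K * r - arctan (v r)"
  proof (rule nondecreasing_if_deriv_nonneg[OF r(1)])
    fix t assume t: "0 \<le> t" "t \<le> r"
    have ne: "1 + (v t)\<^sup>2 \<noteq> 0"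
      by (simp add: add_nonneg_eq_0_iff)
    show "((\<lambda>t. K * t - arctan (v t)) has_real_derivative K - angle_rate n t (u t) (v t)) (at t within {0..r})"
      using t r ne by (auto intro!: derivative_eq_intros DERIV_subset[OF v_deriv] simp: field_simps)
  next
    fix t assume t: "0 < t" "t < r"
    have "(real n - 1) / u t \<le> (real n - 1) / \<alpha>"
      using \<alpha> u_ge[of t] t r dim_real by (intro divide_left_mono mult_pos_pos) auto
    then show "0 \<le> K - angle_rate n t (u t) (v t)"
      using support_bounded[of t] t r by (simp add: K_def angle_rate_support)
  qed
  moreover have "arctan (sqrt 3 / 3) = pi / 6"
    using arctan_unique[of "pi/6" "sqrt 3 / 3"] by (simp add: tan_30 real_div_sqrt field_simps)
  moreover have "K * r \<le> pi / 6"
    using r(3) K by (simp add: free_radius_def K_def[symmetric] field_simps)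
  moreover have "arctan (sqrt 3) = pi / 3"
    using arctan_unique[of "pi/3" "sqrt 3"] by (simp add: tan_60)
  ultimately have "arctan (v r) \<le> arctan (sqrt 3)"
    by (simp add: v_0)
  then show ?thesis
    by (simp add: arctan_le_iff)
qed

lemma slope_bounded:
  assumes r: "0 \<le> r" "r \<le> T"
  shows "v r \<le> slope_bound n \<alpha> \<beta>"
proof -
  let ?C = "support_bound n \<alpha> \<beta>" and ?d = "free_radius n \<alpha> \<beta>"
  have C: "?C > 0" and d: "?d > 0"
    using support_bound_pos free_radius_pos dim \<alpha>(1) \<alpha>\<beta> by auto
  have sqrt3: "sqrt 3 \<le> 2"
    by (rule real_le_lsqrt) auto
  show ?thesis
  proof (cases "r \<le> ?d")
    case True
    have "(\<beta> + ?C) / ?d \<ge> 0"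
      using C d \<alpha> \<alpha>\<beta> by auto
    then show ?thesis
      using slope_before_free_radius[OF r True] sqrt3 by (simp add: slope_bound_def)
  next
    case False
    have "u ?d \<le> \<beta> + 2 * ?d"
    proof -
      have "2 * 0 - u 0 \<le> 2 * ?d - u ?d"
      proof (rule nondecreasing_if_deriv_nonneg[where f = "\<lambda>t. 2 * t - u t" and f' = "\<lambda>t. 2 - v t"])
        show "((\<lambda>t. 2 * t - u t) has_real_derivative 2 - v t) (at t within {0..?d})"
          if "0 \<le> t" "t \<le> ?d" for t
          using that r False by (auto intro!: derivative_eq_intros DERIV_subset[OF u_deriv])
        show "0 \<le> 2 - v t" if "0 < t" "t < ?d" for t
          using that r False slope_before_free_radius[of t] sqrt3 by auto
      qed (use d in auto)
      then show ?thesis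
        using \<beta> u_0 by simp
    qed
    moreover have "- ((u ?d + ?C) / ?d) \<le> - ((u r + ?C) / r)"
    proof (rule nondecreasing_if_deriv_nonneg[where f = "\<lambda>t. - ((u t + ?C) / t)"])
      show "((\<lambda>t. - ((u t + ?C) / t)) has_real_derivative (support t + ?C) / t\<^sup>2) (at t within {?d..r})"
        if "?d \<le> t" "t \<le> r" for t
        using that r d
        by (auto intro!: derivative_eq_intros DERIV_subset[OF u_deriv])
          (simp add: support_def power2_eq_square field_simps)
      show "0 \<le> (support t + ?C) / t\<^sup>2" if "?d < t" "t < r" for t
        using that r d support_bounded[of t] by auto
    qed (use False in auto)
    moreover have "v r \<le> (u r + ?C) / r"
      using support_bounded[OF r] False d by (simp add: support_def field_simps)
    moreover have "(u ?d + ?C) / ?d \<le> (\<beta> + 2 * ?d + ?C) / ?d"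
      using calculation(1) d by (simp add: divide_right_mono)
    moreover have "(\<beta> + 2 * ?d + ?C) / ?d = slope_bound n \<alpha> \<beta>"
      using d by (simp add: slope_bound_def field_simps)
    ultimately show ?thesis
      by linarith
  qed
qed

lemma u_bounded:
  assumes r: "0 \<le> r" "r \<le> T"
  shows "u r \<le> a + slope_bound n \<alpha> \<beta> * r"
proof -
  have "slope_bound n \<alpha> \<beta> * 0 - u 0 \<le> slope_bound n \<alpha> \<beta> * r - u r"
  proof (rule nondecreasing_if_deriv_nonneg[OF r(1)])
    show "((\<lambda>t. slope_bound n \<alpha> \<beta> * t - u t) has_real_derivative slope_bound n \<alpha> \<beta> - v t) (at t within {0..r})"
      if "0 \<le> t" "t \<le> r" for t
      using that r by (auto intro!: derivative_eq_intros DERIV_subset[OF u_deriv])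
    show "0 \<le> slope_bound n \<alpha> \<beta> - v t" if "0 < t" "t < r" for t
      using that r slope_bounded[of t] by auto
  qed
  then show ?thesis
    by (simp add: u_0)
qed

end

end

section \<open>Stability, uniqueness and existence of arcs\<close>

lemma expander_rhs_lipschitz:
  assumes "n \<ge> 2" "0 < \<alpha>" "0 \<le> Q" "0 \<le> T" "\<alpha> \<le> U"
  obtains L :: real where "L \<ge> 0"
    and "\<And>r x x' y y'. \<lbrakk>0 \<le> r; r \<le> T; \<alpha> \<le> x; x \<le> U; \<alpha> \<le> x'; x' \<le> U; 0 \<le> y; y \<le> Q; 0 \<le> y'; y' \<le> Q\<rbrakk>
      \<Longrightarrow> \<bar>(1 + y\<^sup>2) * angle_rate n r x y - (1 + y'\<^sup>2) * angle_rate n r x' y'\<bar>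
          \<le> L * (\<bar>x - x'\<bar> + \<bar>y - y'\<bar>)"
proof -
  define c where "c = real n - 1"
  define B where "B = c / \<alpha>\<^sup>2 + 1 / 2 + T / 2"
  define H where "H = c / \<alpha> + U / 2 + T * Q / 2"
  have c: "c \<ge> 1"
    using \<open>n \<ge> 2\<close> by (simp add: c_def)
  have B: "B \<ge> 0" and H: "H \<ge> 0"
    using c assms by (auto simp: B_def H_def)
  show ?thesis
  proof (rule that[of "(1 + Q\<^sup>2) * B + 2 * Q * H"])
    show "0 \<le> (1 + Q\<^sup>2) * B + 2 * Q * H"
      using B H assms by auto
  next
    fix r x x' y y' :: real
    assume r: "0 \<le> r" "r \<le> T" and x: "\<alpha> \<le> x" "x \<le> U" "\<alpha> \<le> x'" "x' \<le> U"
      and y: "0 \<le> y" "y \<le> Q" "0 \<le> y'" "y' \<le> Q"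
    let ?h = "angle_rate n r x y" and ?h' = "angle_rate n r x' y'"
    let ?d = "\<bar>x - x'\<bar> + \<bar>y - y'\<bar>"
    have "\<bar>1 / x - 1 / x'\<bar> = \<bar>x - x'\<bar> / (x * x')"
      using x \<open>0 < \<alpha>\<close> by (simp add: diff_frac_eq abs_minus_commute abs_mult)
    also have "\<dots> \<le> \<bar>x - x'\<bar> / \<alpha>\<^sup>2"
      unfolding power2_eq_square using x \<open>0 < \<alpha>\<close> by (intro divide_left_mono mult_mono mult_pos_pos) auto
    finally have "c * \<bar>1 / x - 1 / x'\<bar> \<le> c * (\<bar>x - x'\<bar> / \<alpha>\<^sup>2)"
      using c by (intro mult_left_mono) auto
    moreover have "r * \<bar>y - y'\<bar> \<le> T * \<bar>y - y'\<bar>"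
      using r by (intro mult_right_mono) auto
    moreover have "?h - ?h' = c * (1 / x - 1 / x') + (x - x') / 2 - r * (y - y') / 2"
      unfolding angle_rate_def c_def[symmetric] by (simp add: algebra_simps diff_divide_distrib)
    moreover have "\<bar>c * (1 / x - 1 / x') + (x - x') / 2 - r * (y - y') / 2\<bar>
      \<le> \<bar>c * (1 / x - 1 / x')\<bar> + \<bar>(x - x') / 2\<bar> + \<bar>r * (y - y') / 2\<bar>"
      by linarith
    ultimately have "\<bar>?h - ?h'\<bar> \<le> c / \<alpha>\<^sup>2 * \<bar>x - x'\<bar> + \<bar>x - x'\<bar> / 2 + T * \<bar>y - y'\<bar> / 2"
      using c r by (simp add: abs_mult)
    also have "\<dots> \<le> B * ?d"
      using c assms by (simp add: B_def algebra_simps)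
    finally have h_diff: "\<bar>?h - ?h'\<bar> \<le> B * ?d" .
    have "c / x' \<le> c / \<alpha>" "0 \<le> c / x'"
      using c x \<open>0 < \<alpha>\<close> by (auto intro!: divide_left_mono)
    moreover have "r * y' \<le> T * Q" "0 \<le> r * y'"
      using r y by (auto intro!: mult_mono)
    moreover have "\<bar>p + (x' - q) / 2\<bar> \<le> p' + U / 2 + q' / 2"
      if "p \<le> p'" "0 \<le> p" "q \<le> q'" "0 \<le> q" for p p' q q'
      unfolding abs_le_iff using that x \<open>0 < \<alpha>\<close> by (auto simp: field_simps)
    ultimately have h_bound: "\<bar>?h'\<bar> \<le> H"
      unfolding angle_rate_def H_def c_def[symmetric] by blast
    have "\<bar>y\<^sup>2 - y'\<^sup>2\<bar> = \<bar>y - y'\<bar> * (y + y')"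
      using y by (simp add: power2_eq_square square_diff_square_factored abs_mult)
    also have "\<dots> \<le> ?d * (2 * Q)"
      using y by (intro mult_mono) auto
    finally have sq: "\<bar>y\<^sup>2 - y'\<^sup>2\<bar> \<le> ?d * (2 * Q)" .
    have "(1 + y\<^sup>2) * ?h - (1 + y'\<^sup>2) * ?h' = (1 + y\<^sup>2) * (?h - ?h') + (y\<^sup>2 - y'\<^sup>2) * ?h'"
      by (simp add: algebra_simps)
    also have "\<bar>\<dots>\<bar> \<le> (1 + y\<^sup>2) * \<bar>?h - ?h'\<bar> + \<bar>y\<^sup>2 - y'\<^sup>2\<bar> * \<bar>?h'\<bar>"
      by (rule order_trans[OF abs_triangle_ineq]) (simp add: abs_mult)
    also have "\<dots> \<le> (1 + Q\<^sup>2) * (B * ?d) + (?d * (2 * Q)) * H"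
      using h_diff h_bound sq y \<open>0 \<le> Q\<close> by (intro add_mono mult_mono) (auto intro: power_mono)
    also have "\<dots> = ((1 + Q\<^sup>2) * B + 2 * Q * H) * ?d"
      by (simp add: algebra_simps)
    finally show "\<bar>(1 + y\<^sup>2) * ?h - (1 + y'\<^sup>2) * ?h'\<bar> \<le> ((1 + Q\<^sup>2) * B + 2 * Q * H) * ?d" .
  qed
qed

lemma slope_bound_ge_2:
  assumes "n \<ge> 2" "0 < \<alpha>" "\<alpha> \<le> \<beta>"
  shows "slope_bound n \<alpha> \<beta> \<ge> 2"
proof -
  have "(\<beta> + support_bound n \<alpha> \<beta>) / free_radius n \<alpha> \<beta> \<ge> 0"
    using assms support_bound_pos[OF assms] free_radius_pos[OF assms]
    by (intro divide_nonneg_pos) auto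
  then show ?thesis
    by (simp add: slope_bound_def)
qed

text \<open>
  Two arcs stay in the box given by the a priori bounds, where the right-hand side is Lipschitz.
  Hence the squared distance \<open>D\<close> of their phase points satisfies \<open>D' \<le> K D\<close>, and
  \<open>D exp (-K r)\<close> does not increase. The constant depends only on the range of initial radii and
  on the length.
\<close>
lemma expander_arcs_close:
  assumes "n \<ge> 2" "0 < \<alpha>" "\<alpha> \<le> \<beta>" "0 < T"
  obtains E where "\<And>a b u v u' v' t. \<lbrakk>expander_arc n a T u v; expander_arc n b T u' v';
      \<alpha> \<le> a; a \<le> \<beta>; \<alpha> \<le> b; b \<le> \<beta>; 0 \<le> t; t \<le> T\<rbrakk> \<Longrightarrow>
      \<bar>u t - u' t\<bar> \<le> E * \<bar>a - b\<bar> \<and> \<bar>v t - v' t\<bar> \<le> E * \<bar>a - b\<bar>"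
proof -
  define P where "P = slope_bound n \<alpha> \<beta>"
  have P: "P \<ge> 0"
    using slope_bound_ge_2[of n \<alpha> \<beta>] assms by (simp add: P_def)
  have "\<alpha> \<le> \<beta> + P * T"
    using assms P by (simp add: add_increasing2)
  then obtain L where L: "L \<ge> 0"
    and lip: "\<And>r x x' y y'. \<lbrakk>0 \<le> r; r \<le> T; \<alpha> \<le> x; x \<le> \<beta> + P * T; \<alpha> \<le> x'; x' \<le> \<beta> + P * T;
      0 \<le> y; y \<le> P; 0 \<le> y'; y' \<le> P\<rbrakk>
      \<Longrightarrow> \<bar>(1 + y\<^sup>2) * angle_rate n r x y - (1 + y'\<^sup>2) * angle_rate n r x' y'\<bar>
          \<le> L * (\<bar>x - x'\<bar> + \<bar>y - y'\<bar>)"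
    using expander_rhs_lipschitz[OF assms(1,2) P less_imp_le[OF assms(4)]] by metis
  define K where "K = 1 + 3 * L"
  show ?thesis
  proof (rule that[of "sqrt (exp (K * T))"])
    fix a b t :: real and u v u' v'
    assume arc: "expander_arc n a T u v" and arc': "expander_arc n b T u' v'"
      and ab: "\<alpha> \<le> a" "a \<le> \<beta>" "\<alpha> \<le> b" "b \<le> \<beta>" and t: "0 \<le> t" "t \<le> T"
    interpret A: expander_arc n a T u v by (rule arc)
    interpret B: expander_arc n b T u' v' by (rule arc')
    define f where "f r = (1 + (v r)\<^sup>2) * angle_rate n r (u r) (v r)" for r
    define f' where "f' r = (1 + (v' r)\<^sup>2) * angle_rate n r (u' r) (v' r)" for r
    define D where "D r = (u r - u' r)\<^sup>2 + (v r - v' r)\<^sup>2" for r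
    define D' where "D' r = 2 * (u r - u' r) * (v r - v' r) + 2 * (v r - v' r) * (f r - f' r)" for r
    have D_deriv: "(D has_real_derivative D' r) (at r within {0..T})" if "0 \<le> r" "r \<le> T" for r
      unfolding D_def[abs_def] D'_def f_def f'_def
      by (rule derivative_eq_intros A.u_deriv B.u_deriv A.v_deriv B.v_deriv that refl
          | simp add: algebra_simps)+
    have D'_le: "D' r \<le> K * D r" if r: "0 \<le> r" "r \<le> T" for r
    proof -
      let ?x = "\<bar>u r - u' r\<bar>" and ?y = "\<bar>v r - v' r\<bar>"
      have "P * r \<le> P * T"
        using r P by (intro mult_left_mono) auto
      then have "u r \<le> \<beta> + P * T" "u' r \<le> \<beta> + P * T"
        using A.u_bounded[OF \<open>0 < \<alpha>\<close> ab(1,2) r] B.u_bounded[OF \<open>0 < \<alpha>\<close> ab(3,4) r] ab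
        unfolding P_def[symmetric] by linarith+
      then have f_diff: "\<bar>f r - f' r\<bar> \<le> L * (?x + ?y)"
        unfolding f_def f'_def
        using ab r A.slope_pos[OF r] B.slope_pos[OF r] A.u_ge[OF r] B.u_ge[OF r]
          A.slope_bounded[OF \<open>0 < \<alpha>\<close> ab(1,2) r] B.slope_bounded[OF \<open>0 < \<alpha>\<close> ab(3,4) r]
        by (intro lip) (auto simp: P_def)
      have "(u r - u' r) * (v r - v' r) \<le> ?x * ?y"
        by (simp add: abs_mult[symmetric])
      moreover have "(v r - v' r) * (f r - f' r) \<le> ?y * (L * (?x + ?y))"
        by (rule order_trans[OF abs_ge_self]) (use f_diff in \<open>auto simp: abs_mult intro!: mult_left_mono\<close>)
      ultimately have "D' r \<le> 2 * (?x * ?y) + 2 * (?y * (L * (?x + ?y)))"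
        unfolding D'_def mult.assoc by linarith
      also have "\<dots> = 2 * (?x * ?y) + L * (2 * (?x * ?y)) + 2 * L * ?y\<^sup>2"
        by (simp add: algebra_simps power2_eq_square)
      also have "\<dots> \<le> (?x\<^sup>2 + ?y\<^sup>2) + L * (?x\<^sup>2 + ?y\<^sup>2) + 2 * L * (?x\<^sup>2 + ?y\<^sup>2)"
        using L sum_squares_bound[of ?x ?y] by (intro add_mono mult_left_mono) auto
      also have "\<dots> = K * D r"
        by (simp add: K_def D_def algebra_simps)
      finally show ?thesis .
    qed
    have "- (D 0 * exp (- (K * 0))) \<le> - (D t * exp (- (K * t)))"
    proof (rule nondecreasing_if_deriv_nonneg[where f = "\<lambda>r. - (D r * exp (- (K * r)))", OF t(1)])
      show "((\<lambda>r. - (D r * exp (- (K * r)))) has_real_derivative (K * D r - D' r) * exp (- (K * r)))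
          (at r within {0..t})" if "0 \<le> r" "r \<le> t" for r
        using that t
        by (auto intro!: derivative_eq_intros DERIV_subset[OF D_deriv] simp: algebra_simps)
      show "0 \<le> (K * D r - D' r) * exp (- (K * r))" if "0 < r" "r < t" for r
        using that t D'_le[of r] by simp
    qed
    moreover have "D 0 = (a - b)\<^sup>2"
      by (simp add: D_def A.u_0 B.u_0 A.v_0 B.v_0)
    ultimately have "D t \<le> (a - b)\<^sup>2 * exp (K * t)"
      by (simp add: exp_minus field_simps)
    also have "\<dots> \<le> (a - b)\<^sup>2 * exp (K * T)"
      using t L by (intro mult_left_mono) (auto simp: K_def)
    finally have D_le: "D t \<le> (a - b)\<^sup>2 * exp (K * T)" .
    have "\<bar>d\<bar> \<le> sqrt (exp (K * T)) * \<bar>a - b\<bar>" if "d\<^sup>2 \<le> D t" for d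
    proof -
      have "sqrt (d\<^sup>2) \<le> sqrt ((a - b)\<^sup>2 * exp (K * T))"
        using that D_le by (intro real_sqrt_le_mono) simp
      then show ?thesis
        by (simp add: real_sqrt_mult mult.commute)
    qed
    then show "\<bar>u t - u' t\<bar> \<le> sqrt (exp (K * T)) * \<bar>a - b\<bar> \<and>
        \<bar>v t - v' t\<bar> \<le> sqrt (exp (K * T)) * \<bar>a - b\<bar>"
      by (simp add: D_def)
  qed
qed

lemma expander_arc_unique:
  assumes "expander_arc n a T u v" "expander_arc n a T u' v'" "0 \<le> t" "t \<le> T"
  shows "u t = u' t" "v t = v' t"
proof -
  interpret expander_arc n a T u v by fact
  obtain E where "\<And>a' b u v u' v' t. \<lbrakk>expander_arc n a' T u v; expander_arc n b T u' v';
      a \<le> a'; a' \<le> a; a \<le> b; b \<le> a; 0 \<le> t; t \<le> T\<rbrakk> \<Longrightarrow>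
      \<bar>u t - u' t\<bar> \<le> E * \<bar>a' - b\<bar> \<and> \<bar>v t - v' t\<bar> \<le> E * \<bar>a' - b\<bar>"
    using expander_arcs_close[OF dim a_pos order_refl T_pos] by metis
  from this[OF assms(1,2) _ _ _ _ assms(3,4)] show "u t = u' t" "v t = v' t"
    by simp_all
qed

lemma expander_arc_restrict:
  assumes "expander_arc n a T u v" "0 < S" "S \<le> T"
  shows "expander_arc n a S u v"
proof -
  interpret expander_arc n a T u v by fact
  show ?thesis
    using assms(2,3) dim a_pos u_0 v_0 u_pos
    by unfold_locales (auto intro: DERIV_subset[OF u_deriv] DERIV_subset[OF v_deriv])
qed

text \<open>
  Clamping \<open>u\<close> and \<open>u\<^sub>r\<close> to a box makes the right-hand side globally Lipschitz, so the clamped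
  problem is solvable. While its solution is in the box it is an arc, and then the a priori
  bounds place it in the interior; hence it never reaches the boundary.
\<close>
lemma expander_arc_exists:
  assumes "n \<ge> 2" "a > 0" "T > 0"
  obtains u v where "expander_arc n a T u v"
proof -
  define P where "P = slope_bound n a a"
  define Q where "Q = P + 1"
  define U where "U = a + P * T + 1"
  have P2: "P \<ge> 2"
    using slope_bound_ge_2[of n a a] assms by (simp add: P_def)
  then have P: "P \<ge> 0"
    by simp
  have U: "U > a"
    using P assms by (auto simp: U_def intro!: add_nonneg_pos)
  \<comment> \<open>The box \<open>[a/2, U] \<times> [0, Q]\<close> is slightly larger than the region \<open>a \<le> u \<le> a + P T\<close>,
    \<open>0 < u\<^sub>r \<le> P\<close> of the a priori bounds.\<close>
  define cx where "cx x = max (a / 2) (min U x)" for x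
  define cy where "cy y = max 0 (min Q y)" for y :: real
  have cx: "a / 2 \<le> cx x" "cx x \<le> U" "\<bar>cx x - cx x'\<bar> \<le> \<bar>x - x'\<bar>" for x x'
    using U assms by (auto simp: cx_def)
  have cy: "0 \<le> cy y" "cy y \<le> Q" "\<bar>cy y - cy y'\<bar> \<le> \<bar>y - y'\<bar>" for y y'
    using P by (auto simp: cy_def Q_def)
  define F where "F t z = (cy (snd z),
      (1 + (cy (snd z))\<^sup>2) * angle_rate n t (cx (fst z)) (cy (snd z)))" for t and z :: "real \<times> real"
  obtain L where L: "L \<ge> 0"
    and lip: "\<And>r x x' y y'. \<lbrakk>0 \<le> r; r \<le> T; a / 2 \<le> x; x \<le> U; a / 2 \<le> x'; x' \<le> U;
      0 \<le> y; y \<le> Q; 0 \<le> y'; y' \<le> Q\<rbrakk>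
      \<Longrightarrow> \<bar>(1 + y\<^sup>2) * angle_rate n r x y - (1 + y'\<^sup>2) * angle_rate n r x' y'\<bar>
          \<le> L * (\<bar>x - x'\<bar> + \<bar>y - y'\<bar>)"
    by (rule expander_rhs_lipschitz[of n "a / 2" Q T U]) (use assms P U in \<open>auto simp: Q_def\<close>)
  have F_cont: "continuous_on ({0..T} \<times> UNIV) (\<lambda>(t, z). F t z)"
  proof -
    have "cx x \<noteq> 0" for x
      using cx(1)[of x] assms by auto
    then show ?thesis
      unfolding F_def angle_rate_def case_prod_unfold cx_def cy_def
      by (intro continuous_intros) auto
  qed
  have F_lip: "norm (F t z - F t z') \<le> (1 + 2 * L) * norm (z - z')" if t: "0 \<le> t" "t \<le> T" for t z z'
  proof -
    let ?N = "norm (z - z')"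
    have x: "\<bar>fst z - fst z'\<bar> \<le> ?N" and y: "\<bar>snd z - snd z'\<bar> \<le> ?N"
      using norm_fst_le[of "fst z - fst z'" "snd z - snd z'"] norm_snd_le[of "snd z - snd z'" "fst z - fst z'"]
      by (simp_all add: diff_Pair[symmetric] del: diff_Pair)
    have "\<bar>snd (F t z) - snd (F t z')\<bar>
        \<le> L * (\<bar>cx (fst z) - cx (fst z')\<bar> + \<bar>cy (snd z) - cy (snd z')\<bar>)"
      unfolding F_def snd_conv using t by (intro lip cx cy) auto
    also have "\<dots> \<le> L * (?N + ?N)"
      using x y cx(3)[of "fst z" "fst z'"] cy(3)[of "snd z" "snd z'"] L by (intro mult_left_mono) auto
    finally have "\<bar>snd (F t z) - snd (F t z')\<bar> \<le> 2 * L * ?N"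
      by simp
    moreover have "\<bar>fst (F t z) - fst (F t z')\<bar> \<le> ?N"
      using y cy(3)[of "snd z" "snd z'"] by (simp add: F_def)
    moreover have "norm (F t z - F t z') \<le> \<bar>fst (F t z) - fst (F t z')\<bar> + \<bar>snd (F t z) - snd (F t z')\<bar>"
      using norm_Pair_le[of "fst (F t z) - fst (F t z')" "snd (F t z) - snd (F t z')"]
      by (simp add: diff_Pair[symmetric] del: diff_Pair)
    ultimately show ?thesis
      by (simp add: algebra_simps)
  qed
  obtain z where z_0: "z 0 = (a, sqrt 3 / 3)"
    and z_deriv: "\<And>t. 0 \<le> t \<Longrightarrow> t \<le> T \<Longrightarrow> (z has_vector_derivative F t (z t)) (at t within {0..T})"
    using lipschitz_ivp_solvable[OF less_imp_le[OF \<open>T > 0\<close>] F_cont F_lip] by metis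
  define u v where "u = fst \<circ> z" and "v = snd \<circ> z"
  have u_deriv: "(u has_real_derivative cy (v t)) (at t within {0..T})"
    and v_deriv: "(v has_real_derivative (1 + (cy (v t))\<^sup>2) * angle_rate n t (cx (u t)) (cy (v t)))
      (at t within {0..T})"
    if "0 \<le> t" "t \<le> T" for t
    using bounded_linear.has_vector_derivative[OF bounded_linear_fst z_deriv[OF that]]
      bounded_linear.has_vector_derivative[OF bounded_linear_snd z_deriv[OF that]]
    by (simp_all add: u_def v_def o_def F_def has_real_derivative_iff_has_vector_derivative)
  \<comment> \<open>\<open>g > 0\<close> describes the interior of the box.\<close>
  define g where "g t = min (min (u t - a / 2) (U - u t)) (min (v t) (Q - v t))" for t
  have arc: "expander_arc n a t u v" if t: "0 < t" "t \<le> T" and inside: "\<And>s. 0 \<le> s \<Longrightarrow> s \<le> t \<Longrightarrow> g s \<ge> 0" for t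
  proof
    fix r assume r: "0 \<le> r" "r \<le> t"
    have "a / 2 \<le> u r" "u r \<le> U" "0 \<le> v r" "v r \<le> Q"
      using inside[OF r] by (auto simp: g_def)
    then have eq: "cx (u r) = u r" "cy (v r) = v r" and "u r > 0"
      using assms by (auto simp: cx_def cy_def)
    show "u r > 0" by fact
    show "(u has_real_derivative v r) (at r within {0..t})"
      using DERIV_subset[OF u_deriv, of r "{0..t}"] r t by (simp add: eq)
    show "(v has_real_derivative (1 + (v r)\<^sup>2) * angle_rate n r (u r) (v r)) (at r within {0..t})"
      using DERIV_subset[OF v_deriv, of r "{0..t}"] r t by (simp add: eq)
  qed (use assms t z_0 in \<open>simp_all add: u_def v_def\<close>)
  have g_pos: "g t > 0" if t: "0 \<le> t" "t \<le> T" for t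
  proof (rule no_first_zero_imp_pos[where g = g and t = t and a = 0 and b = T])
    have "continuous_on {0..T} u"
      by (rule DERIV_continuous_on, rule u_deriv) auto
    moreover have "continuous_on {0..T} v"
      by (rule DERIV_continuous_on, rule v_deriv) auto
    ultimately show "continuous_on {0..T} g"
      unfolding g_def by (intro continuous_intros)
    have "sqrt 3 \<le> 2"
      by (rule real_le_lsqrt) auto
    then show "0 < g 0"
      using assms U P2 by (auto simp: g_def u_def v_def z_0 Q_def)
  next
    fix t assume t: "0 < t" "t \<le> T" and before: "\<And>s. 0 \<le> s \<Longrightarrow> s < t \<Longrightarrow> 0 < g s"
    show "g t \<noteq> 0"
    proof
      assume zero: "g t = 0"
      then have "g s \<ge> 0" if "0 \<le> s" "s \<le> t" for s
        using before[of s] that by (cases "s = t") auto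
      then interpret expander_arc n a t u v
        using t by (intro arc) auto
      have "P * t \<le> P * T"
        using P t by (intro mult_left_mono) auto
      then have "u t < U"
        using u_bounded[of a a t] t a_pos unfolding P_def[symmetric] U_def by simp
      moreover have "v t < Q"
        using slope_bounded[of a a t] t a_pos unfolding P_def[symmetric] Q_def by simp
      ultimately show False
        using zero u_ge[of t] slope_pos[of t] t a_pos by (simp add: g_def min_def split: if_splits)
    qed
  qed (use t in auto)
  show ?thesis
    using g_pos assms by (intro that[of u v] arc) (simp_all add: less_imp_le)
qed

section \<open>The global profile\<close>

text \<open>
  Phrased through arcs instead of the equation on the half-line, this makes the bounds for
  arcs of every length available.
\<close>
locale expander_ray =
  fixes n :: nat and a :: real and u v :: "real \<Rightarrow> real"
  assumes arc: "\<And>T. T > 0 \<Longrightarrow> expander_arc n a T u v"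

lemma expander_solution_imp_ray:
  assumes "n \<ge> 2" "a > 0" "expander_solution n a u"
  obtains v where "expander_ray n a u v"
proof -
  obtain v w where u_pos: "\<And>r. r \<ge> 0 \<Longrightarrow> u r > 0"
    and u_deriv: "\<And>r. r \<ge> 0 \<Longrightarrow> (u has_real_derivative v r) (at r within {0..})"
    and v_deriv: "\<And>r. r \<ge> 0 \<Longrightarrow> (v has_real_derivative w r) (at r within {0..})"
    and ode: "\<And>r. r \<ge> 0 \<Longrightarrow> w r / (1 + (v r)\<^sup>2) - (real n - 1) / u r + 1/2 * r * v r - 1/2 * u r = 0"
    and init: "u 0 = a" "v 0 = sqrt 3 / 3"
    using assms(3) unfolding expander_solution_def by blast
  have w: "w r = (1 + (v r)\<^sup>2) * angle_rate n r (u r) (v r)" if "r \<ge> 0" for r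
  proof -
    have "1 + (v r)\<^sup>2 > 0"
      by (simp add: add_pos_nonneg)
    moreover have "w r / (1 + (v r)\<^sup>2) = angle_rate n r (u r) (v r)"
      using ode[OF that] unfolding angle_rate_def diff_divide_distrib by linarith
    ultimately show ?thesis
      by (simp add: field_simps)
  qed
  have "expander_arc n a T u v" if "T > 0" for T
  proof
    show "(u has_real_derivative v r) (at r within {0..T})" if "0 \<le> r" "r \<le> T" for r
      using u_deriv[OF that(1)] by (rule DERIV_subset) auto
    show "(v has_real_derivative (1 + (v r)\<^sup>2) * angle_rate n r (u r) (v r)) (at r within {0..T})"
      if "0 \<le> r" "r \<le> T" for r
      using v_deriv[OF that(1)] unfolding w[OF that(1)] by (rule DERIV_subset) auto
  qed (use assms that u_pos init in simp_all)
  then show ?thesis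
    by (intro that[of v] expander_ray.intro)
qed

lemma expander_solution_unique:
  assumes "n \<ge> 2" "a > 0" "expander_solution n a u" "expander_solution n a u'" "r \<ge> 0"
  shows "u r = u' r"
proof -
  obtain v v' where "expander_ray n a u v" "expander_ray n a u' v'"
    using assms expander_solution_imp_ray by metis
  then have "expander_arc n a (r + 1) u v" "expander_arc n a (r + 1) u' v'"
    using assms by (auto simp: expander_ray_def)
  then show ?thesis
    using assms by (intro expander_arc_unique(1)) auto
qed

text \<open>Arcs of growing length agree where both are defined, so they glue to a solution.\<close>
lemma expander_solution_exists:
  assumes "n \<ge> 2" "a > 0"
  shows "\<exists>u. expander_solution n a u"
proof -
  have "\<exists>u v. expander_arc n a T u v" if "T > 0" for T
    using expander_arc_exists[OF assms that] by metis
  then obtain U V where UV: "\<And>T. T > 0 \<Longrightarrow> expander_arc n a T (U T) (V T)"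
    by metis
  \<comment> \<open>Near \<open>r\<close> the glued function agrees with the arc of length \<open>r + 2\<close>, which extends beyond \<open>r + 1\<close>
    and so determines the derivatives at \<open>r\<close>.\<close>
  define u v where "u r = U (r + 1) r" and "v r = V (r + 1) r" for r
  have agree: "u r = U T r" "v r = V T r" if "0 \<le> r" "r + 1 \<le> T" for r T
  proof -
    have "expander_arc n a (r + 1) (U T) (V T)"
      using that by (intro expander_arc_restrict[OF UV]) auto
    then show "u r = U T r" "v r = V T r"
      using expander_arc_unique[OF UV, of "r + 1" "U T" "V T" r] that by (auto simp: u_def v_def)
  qed
  show ?thesis
    unfolding expander_solution_def
  proof (intro exI conjI allI impI)
    fix r :: real assume r: "r \<ge> 0"
    interpret A: expander_arc n a "r + 2" "U (r + 2)" "V (r + 2)"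
      using r by (intro UV) auto
    have at: "at r within {0..r + 2} = at r within {0..}"
      by (rule at_within_nhd[of r "{..<r + 1}"]) auto
    have eq: "u r = U (r + 2) r" "v r = V (r + 2) r"
      using agree[of r "r + 2"] r by auto
    show "u r > 0"
      using A.u_pos r by (simp add: eq)
    show "(u has_real_derivative v r) (at r within {0..})"
    proof (rule has_field_derivative_transform_within[where d = 1])
      show "(U (r + 2) has_real_derivative v r) (at r within {0..})"
        using A.u_deriv[of r] r by (simp add: at eq)
      show "U (r + 2) s = u s" if "s \<in> {0..}" "dist s r < 1" for s
        using agree(1)[of s "r + 2"] that by (auto simp: dist_real_def)
    qed (use r in auto)
    show "(v has_real_derivative (1 + (v r)\<^sup>2) * angle_rate n r (u r) (v r)) (at r within {0..})"
    proof (rule has_field_derivative_transform_within[where d = 1])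
      show "(V (r + 2) has_real_derivative (1 + (v r)\<^sup>2) * angle_rate n r (u r) (v r)) (at r within {0..})"
        using A.v_deriv[of r] r by (simp add: at eq)
      show "V (r + 2) s = v s" if "s \<in> {0..}" "dist s r < 1" for s
        using agree(2)[of s "r + 2"] that by (auto simp: dist_real_def)
    qed (use r in auto)
    have "1 + (v r)\<^sup>2 \<noteq> 0"
      by (simp add: add_nonneg_eq_0_iff)
    then show "(1 + (v r)\<^sup>2) * angle_rate n r (u r) (v r) / (1 + (v r)\<^sup>2)
        - (real n - 1) / u r + 1/2 * r * v r - 1/2 * u r = 0"
      by (simp add: angle_rate_def field_simps)
  next
    interpret expander_arc n a 1 "U 1" "V 1"
      by (intro UV) auto
    show "u 0 = a" "v 0 = sqrt 3 / 3"
      using u_0 v_0 by (simp_all add: u_def v_def)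
  qed
qed

lemma expander_solution_cong:
  assumes "expander_solution n a u" and eq: "\<And>r. r \<ge> 0 \<Longrightarrow> u r = u' r"
  shows "expander_solution n a u'"
proof -
  have transfer: "(u' has_real_derivative d) (at r within {0..})"
    if "r \<ge> 0" "(u has_real_derivative d) (at r within {0..})" for r d
    using that(2) by (rule has_field_derivative_transform_within[where d = 1]) (use that(1) eq in auto)
  obtain v w where sol: "\<forall>r\<ge>0. u r > 0 \<and> (u has_real_derivative v r) (at r within {0..}) \<and>
      (v has_real_derivative w r) (at r within {0..}) \<and>
      w r / (1 + (v r)\<^sup>2) - (real n - 1) / u r + 1/2 * r * v r - 1/2 * u r = 0"
    and init: "u 0 = a" "v 0 = sqrt 3 / 3"
    using assms(1) unfolding expander_solution_def by blast
  show ?thesis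
    unfolding expander_solution_def
  proof (rule exI[of _ v], rule exI[of _ w], intro conjI allI impI)
    fix r :: real assume r: "r \<ge> 0"
    show "u' r > 0" "w r / (1 + (v r)\<^sup>2) - (real n - 1) / u' r + 1/2 * r * v r - 1/2 * u' r = 0"
      using sol[rule_format, OF r] unfolding eq[OF r] by blast+
    show "(u' has_real_derivative v r) (at r within {0..})"
      using sol[rule_format, OF r] transfer[OF r] by blast
    show "(v has_real_derivative w r) (at r within {0..})"
      using sol[rule_format, OF r] by blast
  next
    show "u' 0 = a" "v 0 = sqrt 3 / 3"
      using init eq[of 0] by simp_all
  qed
qed

lemma expander_profile_solution:
  assumes "n \<ge> 2" "a > 0"
  shows "expander_solution n a (expander_profile n a)"
proof -
  obtain u where u: "expander_solution n a u"
    using expander_solution_exists[OF assms] by blast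
  have "\<exists>!u. u \<in> extensional {0..} \<and> expander_solution n a u"
  proof (rule ex1I[of _ "restrict u {0..}"])
    show "restrict u {0..} \<in> extensional {0..} \<and> expander_solution n a (restrict u {0..})"
      using expander_solution_cong[OF u, of "restrict u {0..}"] by auto
    show "u' = restrict u {0..}" if "u' \<in> extensional {0..} \<and> expander_solution n a u'" for u'
      using expander_solution_unique[OF assms u, of u'] that
      by (intro extensionalityI[of _ "{0..}"]) auto
  qed
  then show ?thesis
    unfolding expander_profile_def by (rule theI' [THEN conjunct2])
qed

lemma expander_profile_ray:
  assumes "n \<ge> 2" "a > 0"
  obtains v where "expander_ray n a (expander_profile n a) v"
  using expander_solution_imp_ray[OF assms expander_profile_solution[OF assms]] .

section \<open>The asymptotic slope\<close>

context expander_ray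
begin

sublocale unit_arc: expander_arc n a 1 u v
  by (rule arc) simp

lemma u_deriv_at:
  assumes "r > 0"
  shows "(u has_real_derivative v r) (at r)"
proof -
  interpret expander_arc n a "r + 1" u v
    using assms by (intro arc) simp
  show ?thesis
    using u_deriv[of r] assms by (simp add: at_within_Icc_at)
qed

lemma ray_slope_pos: "r \<ge> 0 \<Longrightarrow> v r > 0"
  using expander_arc.slope_pos[OF arc, of "r + 1" r] by simp

lemma ray_u_ge: "r \<ge> 0 \<Longrightarrow> u r \<ge> a"
  using expander_arc.u_ge[OF arc, of "r + 1" r] by simp

lemma quotient_minus_const_deriv:
  assumes "r > 0"
  shows "((\<lambda>r. (u r - c) / r) has_real_derivative (c - (u r - r * v r)) / r\<^sup>2) (at r)"
  using assms by (auto intro!: derivative_eq_intros u_deriv_at simp: power2_eq_square field_simps)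

text \<open>
  Since \<open>(u/r)' = -(u - r u\<^sub>r)/r\<^sup>2\<close>, a bound \<open>C\<close> on \<open>|u - r u\<^sub>r|\<close> makes \<open>(u - C)/r\<close> increasing
  and \<open>(u + C)/r\<close> decreasing. The two squeeze \<open>u/r\<close> to a limit, at the explicit rate \<open>C/r\<close>.
\<close>
lemma asymptotic_slope_rate:
  assumes C: "\<And>r. r \<ge> 0 \<Longrightarrow> \<bar>u r - r * v r\<bar> \<le> C"
  obtains m where "((\<lambda>r. u r / r) \<longlongrightarrow> m) at_top"
    and "\<And>R. R > 0 \<Longrightarrow> \<bar>u R / R - m\<bar> \<le> C / R"
proof -
  have lower: "(u r - C) / r \<le> (u s - C) / s" if "0 < r" "r \<le> s" for r s
  proof (rule nondecreasing_if_deriv_nonneg[where f = "\<lambda>r. (u r - C) / r", OF that(2)])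
    show "((\<lambda>r. (u r - C) / r) has_real_derivative (C - (u t - t * v t)) / t\<^sup>2) (at t within {r..s})"
      if "r \<le> t" for t
      using that \<open>0 < r\<close> by (intro DERIV_subset[OF quotient_minus_const_deriv]) auto
    show "0 \<le> (C - (u t - t * v t)) / t\<^sup>2" if "r < t" for t
      using C[of t] that \<open>0 < r\<close> by (simp add: abs_le_iff)
  qed
  have upper: "(u s + C) / s \<le> (u r + C) / r" if "0 < r" "r \<le> s" for r s
  proof -
    have "- ((u r - (- C)) / r) \<le> - ((u s - (- C)) / s)"
    proof (rule nondecreasing_if_deriv_nonneg[where f = "\<lambda>r. - ((u r - (- C)) / r)", OF that(2)])
      show "((\<lambda>r. - ((u r - (- C)) / r)) has_real_derivative - ((- C - (u t - t * v t)) / t\<^sup>2)) (at t within {r..s})"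
        if "r \<le> t" for t
        using that \<open>0 < r\<close> by (intro DERIV_subset[OF DERIV_minus[OF quotient_minus_const_deriv]]) auto
      show "0 \<le> - ((- C - (u t - t * v t)) / t\<^sup>2)" if "r < t" for t
        using C[of t] that \<open>0 < r\<close> by (simp add: abs_le_iff divide_nonpos_nonneg)
    qed
    then show ?thesis
      by simp
  qed
  have C_nonneg: "C \<ge> 0"
    using C[of 0] by simp
  have cross: "(u r - C) / r \<le> (u s + C) / s" if "0 < r" "0 < s" for r s
  proof -
    have "(u r - C) / r \<le> (u (max r s) - C) / max r s"
      using that by (intro lower) auto
    also have "\<dots> \<le> (u (max r s) + C) / max r s"
      using that C_nonneg by (intro divide_right_mono) auto
    also have "\<dots> \<le> (u s + C) / s"
      using that by (intro upper) auto
    finally show ?thesis .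
  qed
  define m where "m = (SUP r\<in>{0<..}. (u r - C) / r)"
  have bdd: "bdd_above ((\<lambda>r. (u r - C) / r) ` {0<..})"
    using cross[of _ 1] by (intro bdd_aboveI2) auto
  have rate: "\<bar>u R / R - m\<bar> \<le> C / R" if "R > 0" for R
  proof -
    have "(u R - C) / R \<le> m"
      unfolding m_def using that by (intro cSUP_upper bdd) auto
    moreover have "m \<le> (u R + C) / R"
      unfolding m_def using that cross by (intro cSUP_least) auto
    ultimately show ?thesis
      by (simp add: abs_le_iff diff_divide_distrib add_divide_distrib)
  qed
  have "((\<lambda>r. u r / r - m) \<longlongrightarrow> 0) at_top"
  proof (rule Lim_null_comparison)
    show "\<forall>\<^sub>F r in at_top. norm (u r / r - m) \<le> C / r"
      using eventually_gt_at_top[of 0] by eventually_elim (use rate in auto)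
    show "((\<lambda>r. C / r) \<longlongrightarrow> 0) at_top"
      by (rule tendsto_divide_0[OF tendsto_const]) (simp add: filterlim_at_top_imp_at_infinity filterlim_ident)
  qed
  then have "((\<lambda>r. u r / r) \<longlongrightarrow> m) at_top"
    by (simp add: LIM_zero_iff)
  then show ?thesis
    using that rate by blast
qed

text \<open>
  A positive upper bound on \<open>u - r u\<^sub>r\<close> persists along the ray, so the quotient
  \<open>(u - c)/r\<close> with \<open>c = max 0 (u - r u\<^sub>r)\<close> frozen at \<open>R\<close> does not decrease after \<open>R\<close>;
  its value at \<open>R\<close> is the smaller of \<open>u/R\<close> and \<open>u\<^sub>r\<close>.
\<close>
lemma asymptotic_slope_lower_bound:
  assumes lim: "((\<lambda>r. u r / r) \<longlongrightarrow> m) at_top"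
    and R: "R > 0" and M: "v R \<ge> M" "u R \<ge> M * R"
  shows "m \<ge> M"
proof -
  define c where "c = max 0 (u R - R * v R)"
  have "R * M \<le> R * v R"
    using M R by simp
  then have "u R - c \<ge> M * R"
    using M(2) by (auto simp: c_def max_def mult.commute)
  then have M_le: "M \<le> (u R - c) / R"
    using R by (simp add: field_simps)
  show ?thesis
  proof (rule field_le_epsilon)
    fix e :: real assume e: "e > 0"
    define d where "d = c + e * R"
    have d: "d > 0" "u R - R * v R < d"
      using mult_pos_pos[OF e R] by (auto simp: d_def c_def)
    have below: "u r - r * v r < d" if "r \<ge> R" for r
    proof -
      interpret expander_arc n a "r + 1" u v
        using R that by (intro arc) simp
      show ?thesis
        using support_upper_from[of R r d] that d R by (simp add: support_def)
    qed
    have "(u R - d) / R \<le> u r / r" if "r \<ge> R" for r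
    proof -
      have "(u R - d) / R \<le> (u r - d) / r"
      proof (rule nondecreasing_if_deriv_nonneg[where f = "\<lambda>r. (u r - d) / r", OF that])
        show "((\<lambda>r. (u r - d) / r) has_real_derivative (d - (u t - t * v t)) / t\<^sup>2) (at t within {R..r})"
          if "R \<le> t" for t
          using that R by (intro DERIV_subset[OF quotient_minus_const_deriv]) auto
        show "0 \<le> (d - (u t - t * v t)) / t\<^sup>2" if "R < t" for t
          using below[of t] that by simp
      qed
      also have "\<dots> \<le> u r / r"
        using d R that by (intro divide_right_mono) auto
      finally show ?thesis .
    qed
    then have "(u R - d) / R \<le> m"
      by (intro tendsto_lowerbound[OF lim]) (auto simp: eventually_at_top_linorder)
    moreover have "(u R - d) / R = (u R - c) / R - e"
      using R by (simp add: d_def field_simps)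
    ultimately show "M \<le> m + e"
      using M_le by simp
  qed
qed

end

section \<open>Steep rays at both ends\<close>

context expander_ray
begin

text \<open>
  As long as \<open>u\<^sub>r < M\<close> on \<open>[0,1]\<close>, \<open>u - r u\<^sub>r \<ge> a - M \<ge> a/2\<close>, so the angle \<open>arctan u\<^sub>r\<close> grows at
  rate at least \<open>a/4 \<ge> 2\<close> and would exceed \<open>\<pi>/2\<close> at \<open>r = 1\<close>. At a point of \<open>[0,1]\<close> where \<open>u\<^sub>r \<ge> M\<close>,
  \<open>u \<ge> a \<ge> M r\<close> holds automatically.
\<close>
lemma steep_if_radius_large:
  assumes M: "M \<ge> 1" and a: "a \<ge> 2 * M" "a \<ge> 8"
  obtains R where "R > 0" "v R \<ge> M" "u R \<ge> M * R"
proof -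
  have "\<exists>r. 0 \<le> r \<and> r \<le> 1 \<and> v r \<ge> M"
  proof (rule ccontr)
    assume "\<not> ?thesis"
    then have flat: "v r < M" if "0 \<le> r" "r \<le> 1" for r
      using that by force
    have "arctan (v 0) - 2 * 0 \<le> arctan (v 1) - 2 * 1"
    proof (rule nondecreasing_if_deriv_nonneg[where f = "\<lambda>r. arctan (v r) - 2 * r"])
      fix t :: real assume t: "0 \<le> t" "t \<le> 1"
      have "1 + (v t)\<^sup>2 \<noteq> 0"
        by (simp add: add_nonneg_eq_0_iff)
      then show "((\<lambda>r. arctan (v r) - 2 * r) has_real_derivative angle_rate n t (u t) (v t) - 2)
          (at t within {0..1})"
        using t by (auto intro!: derivative_eq_intros unit_arc.v_deriv simp: field_simps)
    next
      fix t :: real assume t: "0 < t" "t < 1"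
      have "t * v t \<le> 1 * M"
        using t flat[of t] ray_slope_pos[of t] by (intro mult_mono) auto
      then have "u t - t * v t \<ge> 4"
        using ray_u_ge[of t] t a by linarith
      moreover have "(real n - 1) / u t \<ge> 0"
        using unit_arc.u_pos[of t] t unit_arc.dim_real by auto
      ultimately show "0 \<le> angle_rate n t (u t) (v t) - 2"
        using add_mono[of 0 "(real n - 1) / u t" 2 "(u t - t * v t) / 2"] by (simp add: angle_rate_def)
    qed simp
    moreover have "arctan (v 0) > 0"
      using ray_slope_pos[of 0] by (simp add: zero_less_arctan_iff)
    moreover have "arctan (v 1) < 2"
      using arctan_ubound[of "v 1"] pi_less_4 by linarith
    ultimately show False
      by simp
  qed
  then obtain R where R: "0 \<le> R" "R \<le> 1" "v R \<ge> M"
    by blast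
  have "v 0 < 1"
    using real_sqrt_less_mono[of 3 9] by (simp add: unit_arc.v_0)
  then have "R > 0"
    using R M by (cases "R = 0") auto
  moreover have "M * R \<le> M * 1"
    using R M by (intro mult_left_mono) auto
  then have "u R \<ge> M * R"
    using ray_u_ge[of R] R a M by linarith
  ultimately show ?thesis
    using R that by blast
qed

lemma v_has_lower_rate:
  assumes "r \<ge> 0" "angle_rate n r (u r) (v r) \<ge> k" "k \<ge> 0"
  shows "(1 + (v r)\<^sup>2) * angle_rate n r (u r) (v r) \<ge> k"
  using mult_mono[of 1 "1 + (v r)\<^sup>2" k "angle_rate n r (u r) (v r)"] assms by simp

text \<open>
  Near a small radius the equation is that of a catenoid. While \<open>u\<^sub>r < N\<close> the radius is at most
  \<open>a + N r\<close>, whence \<open>u\<^sub>r\<^sub>r \<ge> 1/(2 u) \<ge> 1/(2 (a + N r))\<close>, and integration lets \<open>u\<^sub>r\<close> grow by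
  \<open>ln (1 + N r/a)/(2 N)\<close>. Up to \<open>T = (exp (2 N\<^sup>2) - 1) a/N\<close> this is a growth by \<open>N\<close>. The
  smallness of \<open>a\<close> gives \<open>a + N T = exp (2 N\<^sup>2) a \<le> 1\<close>, which keeps \<open>u\<close> and \<open>r u\<^sub>r\<close> below \<open>1\<close>.
\<close>
lemma slope_reached_if_radius_small:
  assumes N: "N \<ge> 1" and a: "a \<le> exp (- 2 * N\<^sup>2)" and T: "N * T = (exp (2 * N\<^sup>2) - 1) * a"
  obtains R where "0 < R" "R \<le> T" "v R \<ge> N"
proof -
  have a_pos: "a > 0"
    by (rule unit_arc.a_pos)
  have aNT: "a + N * T = exp (2 * N\<^sup>2) * a"
    by (simp add: T algebra_simps)
  also have "\<dots> \<le> exp (2 * N\<^sup>2) * exp (- 2 * N\<^sup>2)"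
    using a by (intro mult_left_mono) auto
  finally have aNT_le: "a + N * T \<le> 1"
    by (simp add: exp_minus)
  have "N * T > 0"
    using N a_pos by (auto simp: T)
  then have T_pos: "T > 0"
    using N by (simp add: zero_less_mult_iff)
  interpret A: expander_arc n a T u v
    by (rule arc[OF T_pos])
  have "\<exists>r. 0 \<le> r \<and> r \<le> T \<and> v r \<ge> N"
  proof (rule ccontr)
    assume "\<not> ?thesis"
    then have flat: "v r < N" if "0 \<le> r" "r \<le> T" for r
      using that by force
    have u_le: "u r \<le> a + N * r" if r: "0 \<le> r" "r \<le> T" for r
    proof -
      have "N * 0 - u 0 \<le> N * r - u r"
      proof (rule nondecreasing_if_deriv_nonneg[where f = "\<lambda>r. N * r - u r", OF r(1)])
        show "((\<lambda>r. N * r - u r) has_real_derivative N - v t) (at t within {0..r})"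
          if "0 \<le> t" "t \<le> r" for t
          using that r by (auto intro!: derivative_eq_intros DERIV_subset[OF A.u_deriv])
        show "0 \<le> N - v t" if "0 < t" "t < r" for t
          using flat[of t] that r by simp
      qed
      then show ?thesis
        by (simp add: A.u_0)
    qed
    have "v 0 - ln (a + N * 0) / (2 * N) \<le> v T - ln (a + N * T) / (2 * N)"
    proof (rule nondecreasing_if_deriv_nonneg[where f = "\<lambda>r. v r - ln (a + N * r) / (2 * N)"])
      fix t assume t: "0 \<le> t" "t \<le> T"
      have "a + N * t > 0"
        using a_pos N t by (intro add_pos_nonneg) auto
      moreover have "((\<lambda>r. a + N * r) has_real_derivative N) (at t within {0..T})"
        by (auto intro!: derivative_eq_intros)
      ultimately have "((\<lambda>r. ln (a + N * r)) has_real_derivative 1 / (a + N * t) * N) (at t within {0..T})"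
        by (intro DERIV_chain2[OF DERIV_ln_divide])
      then have "((\<lambda>r. ln (a + N * r) / (2 * N)) has_real_derivative
          1 / (a + N * t) * N / (2 * N)) (at t within {0..T})"
        by (rule DERIV_cdivide)
      then have "((\<lambda>r. ln (a + N * r) / (2 * N)) has_real_derivative 1 / (2 * (a + N * t))) (at t within {0..T})"
        using N by (simp add: mult.commute)
      then show "((\<lambda>r. v r - ln (a + N * r) / (2 * N)) has_real_derivative
          (1 + (v t)\<^sup>2) * angle_rate n t (u t) (v t) - 1 / (2 * (a + N * t))) (at t within {0..T})"
        using t by (intro DERIV_diff A.v_deriv) auto
    next
      fix t assume t: "0 < t" "t < T"
      have Nt: "N * t \<le> N * T"
        using t N by (intro mult_left_mono) auto
      have u: "u t > 0" "u t \<le> a + N * t"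
        using u_le[of t] A.u_pos[of t] t by auto
      have "u t \<le> 1"
        using u Nt aNT_le by linarith
      then have "1 / u t \<ge> 1"
        using u by (simp add: field_simps)
      moreover have "(real n - 1) / u t \<ge> 1 / u t"
        using u A.dim_real by (intro divide_right_mono) auto
      moreover have "t * v t \<le> t * N"
        using flat[of t] t by (intro mult_left_mono) auto
      then have "t * v t \<le> 1"
        using Nt aNT_le a_pos by (simp add: mult.commute)
      moreover have "e / 2 \<le> k + (x - p) / 2" if "1 \<le> e" "e \<le> k" "p \<le> 1" "0 < x" for e k p x :: real
        using that by (simp add: field_simps)
      ultimately have "angle_rate n t (u t) (v t) \<ge> 1 / u t / 2"
        using u unfolding angle_rate_def by blast
      then have "(1 + (v t)\<^sup>2) * angle_rate n t (u t) (v t) \<ge> 1 / u t / 2"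
        using t u by (intro v_has_lower_rate) auto
      moreover have "1 / (2 * (a + N * t)) \<le> 1 / u t / 2"
        using u by (simp add: frac_le)
      ultimately show "0 \<le> (1 + (v t)\<^sup>2) * angle_rate n t (u t) (v t) - 1 / (2 * (a + N * t))"
        by linarith
    qed (use T_pos in simp)
    also have "ln (a + N * T) = 2 * N\<^sup>2 + ln a"
      using a_pos by (simp add: aNT ln_mult)
    finally have "v 0 + N \<le> v T"
      using N by (simp add: add_divide_distrib power2_eq_square)
    then show False
      using flat[of T] ray_slope_pos[of 0] T_pos by simp
  qed
  then obtain R where R: "0 \<le> R" "R \<le> T" "v R \<ge> N"
    by blast
  have "v 0 < 1"
    using real_sqrt_less_mono[of 3 9] by (simp add: A.v_0)
  then have "R > 0"
    using R N by (cases "R = 0") auto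
  then show ?thesis
    using R that by blast
qed

text \<open>
  Once the slope has reached \<open>4 M\<close> at \<open>R\<close>, it cannot fall to \<open>2 M\<close> on \<open>[R, 2 R]\<close> while
  \<open>u < M r\<close>, because there \<open>u\<close> and \<open>r u\<^sub>r\<close> are so small that \<open>(n - 1)/u\<close> dominates the equation.
  With slope at least \<open>2 M\<close> throughout, \<open>u (2 R) \<ge> 2 M R\<close>, so that both quantities are large at
  \<open>2 R\<close>, if not earlier.
\<close>
lemma steep_if_radius_small:
  assumes M: "M \<ge> 1" and a: "a \<le> exp (- 2 * (4 * M)\<^sup>2)"
  obtains r where "r > 0" "v r \<ge> M" "u r \<ge> M * r"
proof -
  define T where "T = (exp (2 * (4 * M)\<^sup>2) - 1) * a / (4 * M)"
  have T: "4 * M * T = (exp (2 * (4 * M)\<^sup>2) - 1) * a"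
    using M by (simp add: T_def)
  have "exp (2 * (4 * M)\<^sup>2) * a \<le> exp (2 * (4 * M)\<^sup>2) * exp (- 2 * (4 * M)\<^sup>2)"
    using a by (intro mult_left_mono) auto
  also have "\<dots> = 1"
    by (simp add: exp_minus)
  finally have T_le: "4 * M * T \<le> 1"
    using T unit_arc.a_pos by (simp add: algebra_simps)
  obtain R where R: "0 < R" "R \<le> T" "v R \<ge> 4 * M"
    using slope_reached_if_radius_small[OF _ a T] M by auto
  have "4 * M * R \<le> 4 * M * T"
    using R M by (intro mult_left_mono) auto
  then have MR: "4 * (M * R) \<le> 1"
    using T_le by simp
  have "\<exists>r>0. v r \<ge> M \<and> u r \<ge> M * r"
  proof (rule ccontr)
    assume none: "\<not> ?thesis"
    interpret A: expander_arc n a "2 * R" u v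
      using R by (intro arc) simp
    have steep: "v r - 2 * M > 0" if r: "R \<le> r" "r \<le> 2 * R" for r
    proof (rule barrier_imp_pos[where g = "\<lambda>r. v r - 2 * M" and a = R and b = "2 * R"])
      fix t assume t: "R \<le> t" "t \<le> 2 * R"
      show "((\<lambda>r. v r - 2 * M) has_real_derivative (1 + (v t)\<^sup>2) * angle_rate n t (u t) (v t))
          (at t within {R..2 * R})"
        using t R by (auto intro!: derivative_eq_intros DERIV_subset[OF A.v_deriv])
    next
      fix t assume t: "R < t" "t \<le> 2 * R" and "v t - 2 * M = 0"
      then have v: "v t = 2 * M"
        by simp
      have "t > 0" "v t \<ge> M"
        using t R M v by auto
      then have u: "u t < M * t"
        using none not_le by blast
      have u_pos: "u t > 0"
        using A.u_pos[of t] t R by simp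
      have "M * t \<le> M * (2 * R)"
        using t M by (intro mult_left_mono) auto
      then have Mt: "M * t \<le> 1 / 2"
        using MR by simp
      then have "1 / u t > 2"
        using u u_pos by (simp add: field_simps)
      moreover have "(real n - 1) / u t \<ge> 1 / u t"
        using u_pos A.dim_real by (intro divide_right_mono) auto
      moreover have "t * v t \<le> 1"
        using Mt by (simp add: v algebra_simps)
      moreover have "0 < k + (x - p) / 2" if "2 < e" "e \<le> k" "p \<le> 1" "0 < x" for e k p x :: real
        using that by (simp add: field_simps)
      ultimately have "angle_rate n t (u t) (v t) > 0"
        using u_pos unfolding angle_rate_def by blast
      then show "0 < (1 + (v t)\<^sup>2) * angle_rate n t (u t) (v t)"
        by (simp add: add_pos_nonneg)
    qed (use r R M in auto)
    have "u R - 2 * M * R \<le> u (2 * R) - 2 * M * (2 * R)"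
    proof (rule nondecreasing_if_deriv_nonneg[where f = "\<lambda>r. u r - 2 * M * r"])
      show "((\<lambda>r. u r - 2 * M * r) has_real_derivative v t - 2 * M) (at t within {R..2 * R})"
        if "R \<le> t" "t \<le> 2 * R" for t
        using that R by (auto intro!: derivative_eq_intros DERIV_subset[OF A.u_deriv])
      show "0 \<le> v t - 2 * M" if "R < t" "t < 2 * R" for t
        using steep[of t] that by simp
    qed (use R in simp)
    then have "u (2 * R) \<ge> M * (2 * R)"
      using A.u_pos[of R] R by simp
    moreover have "v (2 * R) \<ge> M"
      using steep[of "2 * R"] R M by simp
    ultimately show False
      using none R by auto
  qed
  then show ?thesis
    using that by blast
qed

end

section \<open>The asymptotic slope as a function of the initial radius\<close>

lemma asymptotic_slope_eq:
  assumes "((\<lambda>r. expander_profile n a r / r) \<longlongrightarrow> m) at_top"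
  shows "asymptotic_slope n a = m"
  unfolding asymptotic_slope_def using assms by (intro tendsto_Lim) auto

lemma asymptotic_slope_rate_uniform:
  assumes "n \<ge> 2" "0 < \<alpha>" "\<alpha> \<le> a" "a \<le> \<beta>"
  shows "((\<lambda>r. expander_profile n a r / r) \<longlongrightarrow> asymptotic_slope n a) at_top"
    and "R > 0 \<Longrightarrow> \<bar>expander_profile n a R / R - asymptotic_slope n a\<bar> \<le> support_bound n \<alpha> \<beta> / R"
proof -
  let ?u = "expander_profile n a"
  have "a > 0"
    using assms by simp
  then obtain v where "expander_ray n a ?u v"
    using expander_profile_ray[OF assms(1)] by blast
  then interpret expander_ray n a ?u v .
  have "\<bar>?u r - r * v r\<bar> < support_bound n \<alpha> \<beta>" if "r \<ge> 0" for r
  proof -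
    interpret A: expander_arc n a "r + 1" ?u v
      using that by (intro arc) simp
    show ?thesis
      using A.support_bounded[OF assms(2-4), of r] that by (simp add: A.support_def)
  qed
  from asymptotic_slope_rate[OF less_imp_le[OF this]]
  obtain m where lim: "((\<lambda>r. ?u r / r) \<longlongrightarrow> m) at_top"
    and rate: "\<And>R. R > 0 \<Longrightarrow> \<bar>?u R / R - m\<bar> \<le> support_bound n \<alpha> \<beta> / R"
    by blast
  have "asymptotic_slope n a = m"
    by (rule asymptotic_slope_eq[OF lim])
  then show "((\<lambda>r. ?u r / r) \<longlongrightarrow> asymptotic_slope n a) at_top"
    and "R > 0 \<Longrightarrow> \<bar>?u R / R - asymptotic_slope n a\<bar> \<le> support_bound n \<alpha> \<beta> / R"
    using lim rate by auto
qed

text \<open>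
  The convergence of \<open>u\<^sup>a(R)/R\<close> as \<open>R \<rightarrow> \<infinity>\<close> is uniform for \<open>a\<close> in \<open>[\<alpha>, \<beta>]\<close>, and for fixed \<open>R\<close> the
  quotient is Lipschitz in \<open>a\<close>.
\<close>
lemma continuous_on_asymptotic_slope:
  assumes n: "n \<ge> 2" and \<alpha>: "0 < \<alpha>"
  shows "continuous_on {\<alpha>..\<beta>} (asymptotic_slope n)"
proof (rule uniform_limit_theorem[where F = at_top and f = "\<lambda>R a. expander_profile n a R / R"])
  show "\<forall>\<^sub>F R in at_top. continuous_on {\<alpha>..\<beta>} (\<lambda>a. expander_profile n a R / R)"
    using eventually_gt_at_top[of "0::real"]
  proof eventually_elim
    fix R :: real assume R: "R > 0"
    show "continuous_on {\<alpha>..\<beta>} (\<lambda>a. expander_profile n a R / R)"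
    proof (cases "\<alpha> \<le> \<beta>")
      case True
      obtain E where E: "\<And>a b u v u' v' t. \<lbrakk>expander_arc n a R u v; expander_arc n b R u' v';
          \<alpha> \<le> a; a \<le> \<beta>; \<alpha> \<le> b; b \<le> \<beta>; 0 \<le> t; t \<le> R\<rbrakk> \<Longrightarrow>
          \<bar>u t - u' t\<bar> \<le> E * \<bar>a - b\<bar> \<and> \<bar>v t - v' t\<bar> \<le> E * \<bar>a - b\<bar>"
        using expander_arcs_close[OF n \<alpha> True R] by metis
      have "\<bar>expander_profile n a R - expander_profile n b R\<bar> \<le> \<bar>E\<bar> * \<bar>a - b\<bar>"
        if "a \<in> {\<alpha>..\<beta>}" "b \<in> {\<alpha>..\<beta>}" for a b
      proof -
        have "a > 0" "b > 0"
          using that \<alpha> by auto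
        then obtain v v' where "expander_ray n a (expander_profile n a) v"
          "expander_ray n b (expander_profile n b) v'"
          using expander_profile_ray[OF n] by metis
        then have "\<bar>expander_profile n a R - expander_profile n b R\<bar> \<le> E * \<bar>a - b\<bar>"
          using E[of a "expander_profile n a" v b "expander_profile n b" v' R] that R
          by (auto simp: expander_ray_def)
        also have "\<dots> \<le> \<bar>E\<bar> * \<bar>a - b\<bar>"
          by (intro mult_right_mono) auto
        finally show ?thesis .
      qed
      then have "\<bar>E\<bar>-lipschitz_on {\<alpha>..\<beta>} (\<lambda>a. expander_profile n a R)"
        by (intro lipschitz_onI) (auto simp: dist_real_def)
      then show ?thesis
        using R by (intro continuous_intros lipschitz_on_continuous_on) auto
    qed simp
  qed
next
  show "uniform_limit {\<alpha>..\<beta>} (\<lambda>R a. expander_profile n a R / R) (asymptotic_slope n) at_top"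
  proof (rule uniform_limitI)
    fix e :: real assume "e > 0"
    have "((\<lambda>R. support_bound n \<alpha> \<beta> / R) \<longlongrightarrow> 0) at_top"
      by (rule tendsto_divide_0[OF tendsto_const])
         (simp add: filterlim_at_top_imp_at_infinity filterlim_ident)
    then have "\<forall>\<^sub>F R in at_top. support_bound n \<alpha> \<beta> / R < e"
      using \<open>e > 0\<close> by (rule order_tendstoD(2))
    then show "\<forall>\<^sub>F R in at_top. \<forall>a\<in>{\<alpha>..\<beta>}. dist (expander_profile n a R / R) (asymptotic_slope n a) < e"
      using eventually_gt_at_top[of "0::real"]
    proof eventually_elim
      case (elim R)
      show ?case
      proof
        fix a assume "a \<in> {\<alpha>..\<beta>}"
        then have "\<bar>expander_profile n a R / R - asymptotic_slope n a\<bar> \<le> support_bound n \<alpha> \<beta> / R"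
          using elim by (intro asymptotic_slope_rate_uniform(2)[OF n \<alpha>]) auto
        then show "dist (expander_profile n a R / R) (asymptotic_slope n a) < e"
          using elim by (simp add: dist_real_def)
      qed
    qed
  qed
qed simp

lemma asymptotic_slope_ge:
  assumes n: "n \<ge> 2" and "a > 0" and M: "M \<ge> 1"
    and a: "a \<ge> 2 * M \<and> a \<ge> 8 \<or> a \<le> exp (- 2 * (4 * M)\<^sup>2)"
  shows "asymptotic_slope n a \<ge> M"
proof -
  let ?u = "expander_profile n a"
  obtain v where "expander_ray n a ?u v"
    using expander_profile_ray[OF n \<open>a > 0\<close>] by blast
  then interpret expander_ray n a ?u v .
  obtain R where "R > 0" "v R \<ge> M" "?u R \<ge> M * R"
    using steep_if_radius_large[OF M] steep_if_radius_small[OF M] a by metis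
  then show ?thesis
    by (rule asymptotic_slope_lower_bound
        [OF asymptotic_slope_rate_uniform(1)[OF n \<open>a > 0\<close> order_refl order_refl]])
qed

theorem theorem6p3:
  fixes n :: nat
  assumes "n \<ge> 2"
  shows "\<exists>M0>0. \<forall>M>M0. \<exists>a1>0. \<exists>a2>0.
           a1 \<noteq> a2 \<and> asymptotic_slope n a1 = M \<and> asymptotic_slope n a2 = M"
proof (rule exI[of _ "max 1 (asymptotic_slope n 1)"], intro conjI allI impI)
  show "0 < max 1 (asymptotic_slope n 1)"
    by simp
  fix M assume "M > max 1 (asymptotic_slope n 1)"
  then have M: "M \<ge> 1" "asymptotic_slope n 1 < M"
    by auto
  \<comment> \<open>Initial radii at the two ends for which the asymptotic slope is at least \<open>M\<close>.\<close>
  define a where "a = exp (- 2 * (4 * M)\<^sup>2)"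
  define b where "b = max (2 * M) 8"
  have a: "0 < a" "a \<le> 1" and b: "1 \<le> b"
    by (auto simp: a_def b_def)
  have "asymptotic_slope n a \<ge> M"
    using a by (intro asymptotic_slope_ge assms M) (auto simp: a_def)
  then obtain a1 where a1: "a \<le> a1" "a1 \<le> 1" "asymptotic_slope n a1 = M"
    using IVT2'[of "asymptotic_slope n" 1 M a] M a continuous_on_asymptotic_slope[OF assms] by auto
  have "asymptotic_slope n b \<ge> M"
    using b by (intro asymptotic_slope_ge assms M) (auto simp: b_def)
  then obtain a2 where a2: "1 \<le> a2" "a2 \<le> b" "asymptotic_slope n a2 = M"
    using IVT'[of "asymptotic_slope n" 1 M b] M b continuous_on_asymptotic_slope[OF assms] by auto
  have "a1 \<noteq> a2"
  proof
    assume "a1 = a2"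
    then have "a1 = 1"
      using a1 a2 by simp
    then show False
      using a1 M by simp
  qed
  then show "\<exists>a1>0. \<exists>a2>0. a1 \<noteq> a2 \<and> asymptotic_slope n a1 = M \<and> asymptotic_slope n a2 = M"
    using a a1 a2 by (intro exI[of _ a1] exI[of _ a2] conjI) auto
qed

end
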